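(* Let $G$ be a non-abelian nilpotent Lie group of dimension at most $5$. Then no left-invariant Riemannian metric on $G$ is weakly Einstein.
   Context: An $n$-dimensional Riemannian manifold $(M,g)$ is called weakly Einstein if $\check{R}_{ij}:=R_{iabc}R_{j}{}^{abc}=\frac{\|R\|^2}{n}g_{ij}$, where $R$ is the Riemann curvature tensor (indices raised with $g$, repeated indices summed) and $\|R\|^2=R_{iabc}R^{iabc}$. The function $\|R\|^2$ is not required to be constant in the definition, and Einstein manifolds are not excluded. The curvature tensor is $R(X,Y,U,V)=\langle(\nabla_X\nabla_Y-\nabla_Y\nabla_X-\nabla_{[X,Y]})U,V\rangle$, with $\nabla$ the Levi-Civita connection. Lie groups are taken to be connected, so that being non-abelian and nilpotent are properties of the Lie algebra of $G$ (a non-abelian nilpotent real Lie algebra). *)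

theory Defs
  imports "HOL-Analysis.Analysis"
begin

section \<open>Smooth maps between Euclidean spaces\<close>

primrec Ck_on :: "nat \<Rightarrow> 'a::euclidean_space set \<Rightarrow> ('a \<Rightarrow> 'b::euclidean_space) \<Rightarrow> bool" where
  "Ck_on 0 S f \<longleftrightarrow> continuous_on S f"
| "Ck_on (Suc k) S f \<longleftrightarrow>
     (\<forall>x\<in>S. f differentiable (at x)) \<and> (\<forall>v. Ck_on k S (\<lambda>x. frechet_derivative f (at x) v))"

text \<open>Only meaningful for open \<open>S\<close>.\<close>

definition smooth_on :: "'a::euclidean_space set \<Rightarrow> ('a \<Rightarrow> 'b::euclidean_space) \<Rightarrow> bool" where
  "smooth_on S f \<longleftrightarrow> (\<forall>k. Ck_on k S f)"


section \<open>Smooth manifolds\<close>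

text \<open>The points of the manifold are the elements of the type \<open>'g\<close>; the dimension is
  \<open>DIM('e)\<close>. An atlas need not be maximal.\<close>

type_synonym ('g, 'e) chart = "'g set \<times> ('g \<Rightarrow> 'e)"

definition is_chart :: "('g::topological_space, 'e::euclidean_space) chart \<Rightarrow> bool" where
  "is_chart c \<longleftrightarrow> (case c of (U, \<phi>) \<Rightarrow>
     open U \<and> open (\<phi> ` U) \<and> homeomorphism U (\<phi> ` U) \<phi> (inv_into U \<phi>))"

definition smooth_atlas :: "('g::topological_space, 'e::euclidean_space) chart set \<Rightarrow> bool" where
  "smooth_atlas A \<longleftrightarrow>
     (\<forall>c\<in>A. is_chart c) \<and> (\<Union>(U, \<phi>)\<in>A. U) = UNIV \<and>
     (\<forall>(U, \<phi>)\<in>A. \<forall>(V, \<psi>)\<in>A. smooth_on (\<phi> ` (U \<inter> V)) (\<psi> \<circ> inv_into U \<phi>))"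

definition smooth_fun_on ::
  "('g::topological_space, 'e::euclidean_space) chart set \<Rightarrow> 'g set \<Rightarrow> ('g \<Rightarrow> real) \<Rightarrow> bool" where
  "smooth_fun_on A S f \<longleftrightarrow>
     open S \<and> (\<forall>(U, \<phi>)\<in>A. smooth_on (\<phi> ` (U \<inter> S)) (f \<circ> inv_into U \<phi>))"

definition smooth_at ::
  "('g::topological_space, 'e::euclidean_space) chart set \<Rightarrow> 'g \<Rightarrow> ('g \<Rightarrow> real) \<Rightarrow> bool" where
  "smooth_at A p f \<longleftrightarrow> (\<exists>S. p \<in> S \<and> smooth_fun_on A S f)"

text \<open>A tangent vector at \<open>p\<close> is the directional derivative at \<open>p\<close>, computed in a chart, of
  functions that are smooth near \<open>p\<close>. It is given the value 0 on all other functions, so that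
  equality of tangent vectors is equality in HOL.\<close>

type_synonym 'g tvector = "('g \<Rightarrow> real) \<Rightarrow> real"

definition tangent_space ::
  "('g::topological_space, 'e::euclidean_space) chart set \<Rightarrow> 'g \<Rightarrow> 'g tvector set" where
  "tangent_space A p =
     {v. \<exists>U \<phi> \<xi>. (U, \<phi>) \<in> A \<and> p \<in> U \<and>
        v = (\<lambda>f. if smooth_at A p f
                 then frechet_derivative (f \<circ> inv_into U \<phi>) (at (\<phi> p)) \<xi> else 0)}"

type_synonym 'g vfield = "'g \<Rightarrow> 'g tvector"

definition vf_zero :: "'g vfield" where
  "vf_zero = (\<lambda>p f. 0)"

definition vf_add :: "'g vfield \<Rightarrow> 'g vfield \<Rightarrow> 'g vfield" where
  "vf_add X Y = (\<lambda>p f. X p f + Y p f)"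

definition vf_diff :: "'g vfield \<Rightarrow> 'g vfield \<Rightarrow> 'g vfield" where
  "vf_diff X Y = (\<lambda>p f. X p f - Y p f)"

definition vf_mult :: "('g \<Rightarrow> real) \<Rightarrow> 'g vfield \<Rightarrow> 'g vfield" where
  "vf_mult h X = (\<lambda>p f. h p * X p f)"

definition vf_apply :: "'g vfield \<Rightarrow> ('g \<Rightarrow> real) \<Rightarrow> 'g \<Rightarrow> real" where
  "vf_apply X f = (\<lambda>p. X p f)"

definition smooth_vfields ::
  "('g::topological_space, 'e::euclidean_space) chart set \<Rightarrow> 'g vfield set" where
  "smooth_vfields A =
     {X. (\<forall>p. X p \<in> tangent_space A p) \<and>
         (\<forall>S f. smooth_fun_on A S f \<longrightarrow> smooth_fun_on A S (vf_apply X f))}"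

definition lie_bracket ::
  "('g::topological_space, 'e::euclidean_space) chart set \<Rightarrow> 'g vfield \<Rightarrow> 'g vfield \<Rightarrow> 'g vfield" where
  "lie_bracket A X Y =
     (\<lambda>p f. if smooth_at A p f then X p (vf_apply Y f) - Y p (vf_apply X f) else 0)"


section \<open>Riemannian metrics, Levi-Civita connection, curvature\<close>

type_synonym 'g metric = "'g \<Rightarrow> 'g tvector \<Rightarrow> 'g tvector \<Rightarrow> real"

definition metric_fun :: "'g metric \<Rightarrow> 'g vfield \<Rightarrow> 'g vfield \<Rightarrow> 'g \<Rightarrow> real" where
  "metric_fun g X Y = (\<lambda>p. g p (X p) (Y p))"

definition riemannian_metric ::
  "('g::topological_space, 'e::euclidean_space) chart set \<Rightarrow> 'g metric \<Rightarrow> bool" where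
  "riemannian_metric A g \<longleftrightarrow>
     (\<forall>p. \<forall>u\<in>tangent_space A p. \<forall>v\<in>tangent_space A p.
        g p u v = g p v u \<and>
        (\<forall>w\<in>tangent_space A p. g p (\<lambda>f. u f + v f) w = g p u w + g p v w) \<and>
        (\<forall>c. g p (\<lambda>f. c * u f) v = c * g p u v)) \<and>
     (\<forall>p. \<forall>v\<in>tangent_space A p. v \<noteq> (\<lambda>f. 0) \<longrightarrow> g p v v > 0) \<and>
     (\<forall>X\<in>smooth_vfields A. \<forall>Y\<in>smooth_vfields A. smooth_fun_on A UNIV (metric_fun g X Y))"

text \<open>\<open>D X Y\<close> stands for the covariant derivative of \<open>Y\<close> in direction \<open>X\<close>. The values of \<open>D\<close>
  outside the smooth vector fields are irrelevant.\<close>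

type_synonym 'g connection = "'g vfield \<Rightarrow> 'g vfield \<Rightarrow> 'g vfield"

definition affine_connection ::
  "('g::topological_space, 'e::euclidean_space) chart set \<Rightarrow> 'g connection \<Rightarrow> bool" where
  "affine_connection A D \<longleftrightarrow>
     (\<forall>X\<in>smooth_vfields A. \<forall>Y\<in>smooth_vfields A.
        D X Y \<in> smooth_vfields A \<and>
        (\<forall>Z\<in>smooth_vfields A.
           D (vf_add X Z) Y = vf_add (D X Y) (D Z Y) \<and>
           D X (vf_add Y Z) = vf_add (D X Y) (D X Z)) \<and>
        (\<forall>h. smooth_fun_on A UNIV h \<longrightarrow>
           D (vf_mult h X) Y = vf_mult h (D X Y) \<and>
           D X (vf_mult h Y) = vf_add (vf_mult (vf_apply X h) Y) (vf_mult h (D X Y))))"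

definition levi_civita ::
  "('g::topological_space, 'e::euclidean_space) chart set \<Rightarrow> 'g metric \<Rightarrow> 'g connection \<Rightarrow> bool" where
  "levi_civita A g D \<longleftrightarrow>
     affine_connection A D \<and>
     (\<forall>X\<in>smooth_vfields A. \<forall>Y\<in>smooth_vfields A.
        vf_diff (D X Y) (D Y X) = lie_bracket A X Y \<and>
        (\<forall>Z\<in>smooth_vfields A. \<forall>p.
           X p (metric_fun g Y Z) = g p (D X Y p) (Z p) + g p (Y p) (D X Z p)))"

definition curvature_operator ::
  "('g::topological_space, 'e::euclidean_space) chart set \<Rightarrow> 'g connection \<Rightarrow>
   'g vfield \<Rightarrow> 'g vfield \<Rightarrow> 'g vfield \<Rightarrow> 'g vfield" where
  "curvature_operator A D X Y U =
     vf_diff (vf_diff (D X (D Y U)) (D Y (D X U))) (D (lie_bracket A X Y) U)"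

definition curvature_tensor ::
  "('g::topological_space, 'e::euclidean_space) chart set \<Rightarrow> 'g metric \<Rightarrow> 'g connection \<Rightarrow>
   'g vfield \<Rightarrow> 'g vfield \<Rightarrow> 'g vfield \<Rightarrow> 'g vfield \<Rightarrow> 'g \<Rightarrow> real" where
  "curvature_tensor A g D X Y U V = metric_fun g (curvature_operator A D X Y U) V"


section \<open>Weakly Einstein metrics\<close>

text \<open>Index calculus for components \<open>R i a b c\<close> with respect to a frame indexed by \<open>{..<n}\<close>,
  where \<open>gi i j\<close> are the entries of the inverse Gram matrix (the metric with raised indices).\<close>

definition raise3 :: "nat \<Rightarrow> (nat \<Rightarrow> nat \<Rightarrow> real) \<Rightarrow> (nat \<Rightarrow> nat \<Rightarrow> nat \<Rightarrow> nat \<Rightarrow> real) \<Rightarrow>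
    nat \<Rightarrow> nat \<Rightarrow> nat \<Rightarrow> nat \<Rightarrow> real" where
  "raise3 n gi R j a b c =
     (\<Sum>a'<n. \<Sum>b'<n. \<Sum>c'<n. gi a a' * gi b b' * gi c c' * R j a' b' c')"

definition R_check :: "nat \<Rightarrow> (nat \<Rightarrow> nat \<Rightarrow> real) \<Rightarrow> (nat \<Rightarrow> nat \<Rightarrow> nat \<Rightarrow> nat \<Rightarrow> real) \<Rightarrow>
    nat \<Rightarrow> nat \<Rightarrow> real" where
  "R_check n gi R i j = (\<Sum>a<n. \<Sum>b<n. \<Sum>c<n. R i a b c * raise3 n gi R j a b c)"

definition R_norm_sq :: "nat \<Rightarrow> (nat \<Rightarrow> nat \<Rightarrow> real) \<Rightarrow> (nat \<Rightarrow> nat \<Rightarrow> nat \<Rightarrow> nat \<Rightarrow> real) \<Rightarrow> real" where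
  "R_norm_sq n gi R =
     (\<Sum>i<n. \<Sum>a<n. \<Sum>b<n. \<Sum>c<n. R i a b c * (\<Sum>i'<n. gi i i' * raise3 n gi R i' a b c))"

text \<open>The Levi-Civita connection exists and is unique, so the existential quantifier over \<open>D\<close>
  selects it. The condition on \<open>gi\<close> says that the Gram matrix of the \<open>DIM('e)\<close> tangent vectors
  \<open>E i p\<close> is invertible with inverse \<open>gi\<close>; in particular these vectors form a basis of the tangent
  space at \<open>p\<close>. Every basis of a tangent space extends to global smooth vector fields.\<close>

definition weakly_einstein ::
  "('g::topological_space, 'e::euclidean_space) chart set \<Rightarrow> 'g metric \<Rightarrow> bool" where
  "weakly_einstein A g \<longleftrightarrow> (\<exists>D. levi_civita A g D \<and>
     (\<forall>p E gi.
        (\<forall>i<DIM('e). E i \<in> smooth_vfields A) \<and>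
        (\<forall>i<DIM('e). \<forall>k<DIM('e).
           (\<Sum>j<DIM('e). gi i j * g p (E j p) (E k p)) = (if i = k then 1 else 0)) \<longrightarrow>
        (let R = (\<lambda>i a b c. curvature_tensor A g D (E i) (E a) (E b) (E c) p) in
         \<forall>i<DIM('e). \<forall>j<DIM('e).
           R_check DIM('e) gi R i j
             = R_norm_sq DIM('e) gi R / real DIM('e) * g p (E i p) (E j p))))"


section \<open>Lie groups and their Lie algebras\<close>

text \<open>The class \<open>group_add\<close> of not necessarily commutative groups is written additively, hence so
  are Lie groups: the group law is \<open>+\<close>, the unit is \<open>0\<close>.\<close>

definition lie_group ::
  "('g::{topological_group_add, t2_space, second_countable_topology},
    'e::euclidean_space) chart set \<Rightarrow> bool" where
  "lie_group A \<longleftrightarrow>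
     smooth_atlas A \<and>
     (\<forall>(U, \<phi>)\<in>A. \<forall>(V, \<psi>)\<in>A. \<forall>(W, \<theta>)\<in>A.
        smooth_on {(x, y). x \<in> \<phi> ` U \<and> y \<in> \<psi> ` V \<and> inv_into U \<phi> x + inv_into V \<psi> y \<in> W}
          (\<lambda>(x, y). \<theta> (inv_into U \<phi> x + inv_into V \<psi> y))) \<and>
     (\<forall>(U, \<phi>)\<in>A. \<forall>(V, \<psi>)\<in>A.
        smooth_on {x \<in> \<phi> ` U. - inv_into U \<phi> x \<in> V} (\<lambda>x. \<psi> (- inv_into U \<phi> x)))"

text \<open>The differential of the left translation by \<open>a\<close>.\<close>

definition left_push :: "'g::group_add \<Rightarrow> 'g tvector \<Rightarrow> 'g tvector" where
  "left_push a v = (\<lambda>f. v (\<lambda>q. f (a + q)))"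

text \<open>The Lie algebra of the group, as the set of its left-invariant vector fields.\<close>

definition lie_algebra ::
  "('g::{topological_group_add, t2_space, second_countable_topology},
    'e::euclidean_space) chart set \<Rightarrow> 'g vfield set" where
  "lie_algebra A = {X \<in> smooth_vfields A. \<forall>a p. X (a + p) = left_push a (X p)}"

definition vf_span :: "'g vfield set \<Rightarrow> 'g vfield set" where
  "vf_span S = {\<lambda>p f. (\<Sum>i<m. c i * X i p f) | (m::nat) c X. \<forall>i<m. X i \<in> S}"

definition abelian_lie_algebra ::
  "('g::topological_space, 'e::euclidean_space) chart set \<Rightarrow> 'g vfield set \<Rightarrow> bool" where
  "abelian_lie_algebra A L \<longleftrightarrow> (\<forall>X\<in>L. \<forall>Y\<in>L. lie_bracket A X Y = vf_zero)"

primrec lower_central_series ::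
  "('g::topological_space, 'e::euclidean_space) chart set \<Rightarrow> 'g vfield set \<Rightarrow> nat \<Rightarrow>
   'g vfield set" where
  "lower_central_series A L 0 = L"
| "lower_central_series A L (Suc k) =
     vf_span {lie_bracket A X Y | X Y. X \<in> L \<and> Y \<in> lower_central_series A L k}"

definition nilpotent_lie_algebra ::
  "('g::topological_space, 'e::euclidean_space) chart set \<Rightarrow> 'g vfield set \<Rightarrow> bool" where
  "nilpotent_lie_algebra A L \<longleftrightarrow> (\<exists>k. lower_central_series A L k = {vf_zero})"

definition left_invariant_metric ::
  "('g::{topological_group_add, t2_space, second_countable_topology},
    'e::euclidean_space) chart set \<Rightarrow> 'g metric \<Rightarrow> bool" where
  "left_invariant_metric A g \<longleftrightarrow>
     (\<forall>a p. \<forall>u\<in>tangent_space A p. \<forall>v\<in>tangent_space A p.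
        g (a + p) (left_push a u) (left_push a v) = g p u v)"

end

theory Submission
  imports Defs
begin

text \<open>
  Nilpotency yields an orthonormal frame \<open>e\<^sub>0, \<dots>, e\<^sub>n\<^sub>-\<^sub>1\<close> of left-invariant vector fields that is
  adapted to a descending central series: \<open>[e\<^sub>i, e\<^sub>j]\<close> lies in the span of the \<open>e\<^sub>k\<close> with
  \<open>k < min i j\<close>. In particular \<open>e\<^sub>0\<close> is central, and for \<open>n \<le> 5\<close> there are only ten structure
  constants. By Koszul's formula the components of the curvature tensor are quadratic polynomials in
  them. The weakly Einstein condition gives \<open>|R|\<^sup>2 = n R_check\<^sub>0\<^sub>0 \<le> 5 R_check\<^sub>0\<^sub>0\<close>, but
  \<open>|R|\<^sup>2 - 5 R_check\<^sub>0\<^sub>0\<close> is a quartic form in the structure constants that is positive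
  unless all of them vanish.
\<close>

section \<open>Calculus of smooth maps\<close>

text \<open>The trace of \<open>R_check\<close> is |R|^2, so the condition makes every unit vector
  carry exactly 1/n of |R|^2. A central test vector is chosen because it carries too little: a
  single bracket [e_1, e_2] = a e_0 gives sectional curvature a^2/4 to the planes spanned by e_0
  with e_1 or e_2, but -3 a^2/4 to the plane of e_1 and e_2, and squaring turns the ratio 3 into 9.
  The quartic inequality is proved for ten free reals, not only on the variety a j = 0, a i - b h +
  c g = 0 cut out by the Jacobi identity. Lower dimensions are reached by appending flat directions
  behind the frame, so that e_0 keeps its index. The obstacle before all this is that tangent
  vectors are functionals on functions. Therefore \<open>'e\<close> is first identified with the Lie
  algebra by \<open>left_field\<close>; bracket, metric and connection are transported to
  \<open>bracket\<close>, \<open>lie_inner\<close> and \<open>nabla\<close> on \<open>'e\<close>,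
  where only linear algebra remains.\<close>

lemma has_derivative_cong_open:
  assumes "open S" "x \<in> S" "\<And>y. y \<in> S \<Longrightarrow> f y = g y"
  shows "(f has_derivative D) (at x) \<longleftrightarrow> (g has_derivative D) (at x)"
  using assms by (auto elim!: has_derivative_transform_within_open)

lemma frechet_derivative_cong_open:
  assumes "open S" "x \<in> S" "\<And>y. y \<in> S \<Longrightarrow> f y = g y"
  shows "frechet_derivative f (at x) = frechet_derivative g (at x)"
  unfolding frechet_derivative_def using has_derivative_cong_open[where f = f and g = g, OF assms] by simp

lemma differentiable_cong_open:
  assumes "open S" "x \<in> S" "\<And>y. y \<in> S \<Longrightarrow> f y = g y"
  shows "f differentiable (at x) \<longleftrightarrow> g differentiable (at x)"
  unfolding differentiable_def using has_derivative_cong_open[where f = f and g = g, OF assms] by simp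

text \<open>Openness of S lets agreement on S pass to the Frechet derivatives at points of S; each
  induction step replaces f and g by their directional derivatives.\<close>

lemma Ck_on_cong:
  assumes "open S" "\<And>y. y \<in> S \<Longrightarrow> f y = g y"
  shows "Ck_on k S f \<longleftrightarrow> Ck_on k S g"
  using assms(2)
proof (induction k arbitrary: f g)
  case 0
  then show ?case by (simp cong: continuous_on_cong)
next
  case (Suc k)
  have "Ck_on k S (\<lambda>x. frechet_derivative f (at x) v)
      \<longleftrightarrow> Ck_on k S (\<lambda>x. frechet_derivative g (at x) v)" for v
    using frechet_derivative_cong_open[where f = f and g = g, OF assms(1) _ Suc.prems] by (intro Suc.IH) auto
  moreover have "f differentiable (at x) \<longleftrightarrow> g differentiable (at x)" if "x \<in> S" for x
    using assms(1) that Suc.prems by (rule differentiable_cong_open)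
  ultimately show ?case by simp
qed

lemma Ck_on_subset: "Ck_on k S f \<Longrightarrow> T \<subseteq> S \<Longrightarrow> Ck_on k T f"
  by (induction k arbitrary: f) (auto intro: continuous_on_subset)

lemma Ck_on_locally:
  assumes "\<And>x. x \<in> S \<Longrightarrow> \<exists>T. open T \<and> x \<in> T \<and> Ck_on k T f"
  shows "Ck_on k S f"
  using assms
proof (induction k arbitrary: f)
  case 0
  show ?case
    unfolding Ck_on.simps
  proof (rule continuous_at_imp_continuous_on, rule ballI)
    fix x assume "x \<in> S"
    with 0 obtain T where "open T" "x \<in> T" "continuous_on T f" by auto
    then show "isCont f x" using continuous_on_eq_continuous_at by blast
  qed
next
  case (Suc k)
  show ?case
    unfolding Ck_on.simps
  proof (intro conjI ballI allI)
    fix x assume "x \<in> S"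
    with Suc.prems show "f differentiable (at x)" by fastforce
  next
    fix v
    show "Ck_on k S (\<lambda>x. frechet_derivative f (at x) v)"
      using Suc.prems by (intro Suc.IH) fastforce
  qed
qed

text \<open>\<open>Ck_on (Suc k)\<close> speaks only of differentiability and of the derivatives, so
  the descent is an induction whose base case is that differentiability implies continuity.\<close>

lemma Ck_on_SucD: "Ck_on (Suc k) S f \<Longrightarrow> Ck_on k S f"
proof (induction k arbitrary: f)
  case 0
  then show ?case
    by (simp add: continuous_at_imp_continuous_on differentiable_imp_continuous_within)
next
  case (Suc k)
  then show ?case
    unfolding Ck_on.simps(2)[of "Suc k"] Ck_on.simps(2)[of k S f] by blast
qed

lemma Ck_on_const: "Ck_on k S (\<lambda>x. c)"
  by (induction k arbitrary: c) (auto simp: frechet_derivative_const)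

lemma Ck_on_bounded_linear: "bounded_linear L \<Longrightarrow> Ck_on k S L"
proof (cases k)
  case (Suc m)
  assume L: "bounded_linear L"
  then have "frechet_derivative L (at x) = L" for x
    by (metis bounded_linear_imp_has_derivative frechet_derivative_at)
  with L Suc show ?thesis
    by (auto simp: Ck_on_const bounded_linear_imp_differentiable)
qed (auto intro: linear_continuous_on)

lemma Ck_on_add:
  assumes "open S" "Ck_on k S f" "Ck_on k S g"
  shows "Ck_on k S (\<lambda>x. f x + g x)"
  using assms(2,3)
proof (induction k arbitrary: f g)
  case 0
  then show ?case by (simp add: continuous_on_add)
next
  case (Suc k)
  then have "frechet_derivative (\<lambda>x. f x + g x) (at x) v
      = frechet_derivative f (at x) v + frechet_derivative g (at x) v" if "x \<in> S" for x v
    using that frechet_derivative_at[OF has_derivative_add[of f _ "at x" g]]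
    by (simp add: frechet_derivative_works fun_eq_iff)
  then have "Ck_on k S (\<lambda>x. frechet_derivative (\<lambda>x. f x + g x) (at x) v)" for v
    using Suc by (subst Ck_on_cong[OF assms(1)]) auto
  then show ?case using Suc.prems by (simp add: differentiable_add)
qed

text \<open>By the product rule the derivative is a sum of two products of the same kind, each
  pairing one factor, lowered by \<open>Ck_on_SucD\<close>, with a derivative of the other. Serves
  both \<open>inner\<close> and \<open>scaleR\<close>.\<close>

lemma Ck_on_bounded_bilinear:
  assumes "bounded_bilinear P" "open S" "Ck_on k S f" "Ck_on k S g"
  shows "Ck_on k S (\<lambda>x. P (f x) (g x))"
  using assms(3,4)
proof (induction k arbitrary: f g)
  case 0
  then show ?case by (simp add: bounded_bilinear.continuous_on[OF assms(1)])
next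
  case (Suc k)
  have D: "((\<lambda>x. P (f x) (g x)) has_derivative
      (\<lambda>v. P (f x) (frechet_derivative g (at x) v) + P (frechet_derivative f (at x) v) (g x))) (at x)"
    if "x \<in> S" for x
    using Suc.prems that
    by (intro bounded_bilinear.FDERIV[OF assms(1)]) (auto simp: frechet_derivative_works[symmetric])
  have "Ck_on k S (\<lambda>x. frechet_derivative (\<lambda>x. P (f x) (g x)) (at x) v)" for v
  proof (subst Ck_on_cong[OF assms(2)])
    show "frechet_derivative (\<lambda>x. P (f x) (g x)) (at x) v
        = P (f x) (frechet_derivative g (at x) v) + P (frechet_derivative f (at x) v) (g x)"
      if "x \<in> S" for x
      using frechet_derivative_at[OF D[OF that]] by metis
    show "Ck_on k S (\<lambda>x. P (f x) (frechet_derivative g (at x) v)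
        + P (frechet_derivative f (at x) v) (g x))"
      using Suc.prems Ck_on_SucD[OF Suc.prems(1)] Ck_on_SucD[OF Suc.prems(2)]
      by (intro Ck_on_add Suc.IH assms(2)) auto
  qed
  then show ?case using D unfolding Ck_on.simps differentiable_def by blast
qed

lemma Ck_on_sum:
  assumes "open S" "\<And>i. i \<in> I \<Longrightarrow> Ck_on k S (f i)"
  shows "Ck_on k S (\<lambda>x. \<Sum>i\<in>I. f i x)"
  using assms(2) by (induction I rule: infinite_finite_induct)
    (auto simp: Ck_on_const intro!: Ck_on_add[OF assms(1)])

lemma Ck_on_compose:
  fixes f :: "'a::euclidean_space \<Rightarrow> 'b::euclidean_space" and g :: "'b \<Rightarrow> 'c::euclidean_space"
  assumes "open S" "open T" "f ` S \<subseteq> T" "Ck_on k S f" "Ck_on k T g"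
  shows "Ck_on k S (\<lambda>x. g (f x))"
  using assms(4,5)
proof (induction k arbitrary: g)
  case 0
  then show ?case using assms(3) by (auto intro: continuous_on_compose2)
next
  case (Suc k)
  have f': "Ck_on k S f" by (rule Ck_on_SucD[OF Suc.prems(1)])
  have D: "((\<lambda>x. g (f x)) has_derivative
      (\<lambda>v. frechet_derivative g (at (f x)) (frechet_derivative f (at x) v))) (at x)"
    if "x \<in> S" for x
    using Suc.prems that assms(3) diff_chain_at[of f _ x g]
    by (auto simp: frechet_derivative_works image_subset_iff o_def)
  have "Ck_on k S (\<lambda>x. frechet_derivative (\<lambda>x. g (f x)) (at x) v)" for v
  proof (subst Ck_on_cong[OF assms(1)])
    fix x assume x: "x \<in> S"
    let ?w = "frechet_derivative f (at x) v"
    have lin: "linear (frechet_derivative g (at (f x)))"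
      using Suc.prems x assms(3) by (auto intro!: linear_frechet_derivative)
    have "frechet_derivative (\<lambda>x. g (f x)) (at x) v = frechet_derivative g (at (f x)) ?w"
      using frechet_derivative_at[OF D[OF x]] by metis
    \<comment> \<open>The direction ?w moves with x, while \<open>Ck_on\<close> controls derivatives
      in fixed directions only; hence the expansion over \<open>Basis\<close>.\<close>
    also have "\<dots> = frechet_derivative g (at (f x)) (\<Sum>b\<in>Basis. (?w \<bullet> b) *\<^sub>R b)"
      by (simp add: euclidean_representation)
    also have "\<dots> = (\<Sum>b\<in>Basis. (?w \<bullet> b) *\<^sub>R frechet_derivative g (at (f x)) b)"
      by (simp add: linear_sum[OF lin] linear_scale[OF lin])
    finally show "frechet_derivative (\<lambda>x. g (f x)) (at x) v
        = (\<Sum>b\<in>Basis. (?w \<bullet> b) *\<^sub>R frechet_derivative g (at (f x)) b)" .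
  next
    have "Ck_on k S (\<lambda>x. frechet_derivative g (at (f x)) b)" for b
      using Suc.prems f' by (intro Suc.IH) auto
    moreover have "Ck_on k S (\<lambda>x. frechet_derivative f (at x) v \<bullet> b)" for b
      using Suc.prems
      by (intro Ck_on_bounded_bilinear[OF bounded_bilinear_inner assms(1)] Ck_on_const) auto
    ultimately show "Ck_on k S (\<lambda>x. \<Sum>b\<in>Basis.
        (frechet_derivative f (at x) v \<bullet> b) *\<^sub>R frechet_derivative g (at (f x)) b)"
      by (intro Ck_on_sum Ck_on_bounded_bilinear[OF bounded_bilinear_scaleR] assms(1))
  qed
  then show ?case using D unfolding Ck_on.simps differentiable_def by blast
qed

lemma smooth_on_cong:
  "open S \<Longrightarrow> (\<And>y. y \<in> S \<Longrightarrow> f y = g y) \<Longrightarrow> smooth_on S f \<longleftrightarrow> smooth_on S g"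
  unfolding smooth_on_def using Ck_on_cong by blast

lemma smooth_on_subset: "smooth_on S f \<Longrightarrow> T \<subseteq> S \<Longrightarrow> smooth_on T f"
  unfolding smooth_on_def using Ck_on_subset by blast

lemma smooth_on_locally:
  "(\<And>x. x \<in> S \<Longrightarrow> \<exists>T. open T \<and> x \<in> T \<and> smooth_on T f) \<Longrightarrow> smooth_on S f"
  unfolding smooth_on_def by (meson Ck_on_locally)

lemma smooth_on_const: "smooth_on S (\<lambda>x. c)"
  unfolding smooth_on_def by (simp add: Ck_on_const)

lemma smooth_on_bounded_linear: "bounded_linear L \<Longrightarrow> smooth_on S L"
  unfolding smooth_on_def by (simp add: Ck_on_bounded_linear)

lemma smooth_on_add:
  "open S \<Longrightarrow> smooth_on S f \<Longrightarrow> smooth_on S g \<Longrightarrow> smooth_on S (\<lambda>x. f x + g x)"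
  unfolding smooth_on_def by (simp add: Ck_on_add)

lemma smooth_on_compose:
  "open S \<Longrightarrow> open T \<Longrightarrow> f ` S \<subseteq> T \<Longrightarrow> smooth_on S f \<Longrightarrow> smooth_on T g
    \<Longrightarrow> smooth_on S (\<lambda>x. g (f x))"
  unfolding smooth_on_def by (blast intro: Ck_on_compose)

lemma smooth_on_diff:
  assumes "open S" "smooth_on S f" "smooth_on S g"
  shows "smooth_on S (\<lambda>x. f x - g x)"
proof -
  have "smooth_on S (\<lambda>x. - g x)"
    using assms smooth_on_compose[of S UNIV g uminus]
    by (simp add: smooth_on_bounded_linear bounded_linear_minus[OF bounded_linear_ident])
  with smooth_on_add[OF assms(1,2)] show ?thesis by fastforce
qed

lemma smooth_on_frechet_derivative:
  "smooth_on S f \<Longrightarrow> smooth_on S (\<lambda>x. frechet_derivative f (at x) v)"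
  unfolding smooth_on_def by (metis Ck_on.simps(2))

lemma smooth_on_imp_differentiable: "smooth_on S f \<Longrightarrow> x \<in> S \<Longrightarrow> f differentiable (at x)"
  unfolding smooth_on_def by (metis Ck_on.simps(2))

lemma smooth_on_Pair_left: "smooth_on S (\<lambda>y. (x, y))"
  and smooth_on_Pair_right: "smooth_on S (\<lambda>y. (y, x))"
proof -
  have "smooth_on UNIV (\<lambda>y. (x, 0) + (0, y))" "smooth_on UNIV (\<lambda>y. (y, 0) + (0, x))"
    by (intro smooth_on_add smooth_on_const smooth_on_bounded_linear bounded_linear_Pair
        bounded_linear_zero bounded_linear_ident open_UNIV)+
  then show "smooth_on S (\<lambda>y. (x, y))" "smooth_on S (\<lambda>y. (y, x))"
    by (auto intro: smooth_on_subset)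
qed

section \<open>Left-invariant vector fields\<close>

text \<open>Names the functional under the existential quantifier of \<open>tangent_space\<close>,
  so that its linear dependence on the coordinate vector \<xi> can be stated.\<close>

definition chart_vector ::
  "('g::topological_space, 'e::euclidean_space) chart set \<Rightarrow> 'g set \<Rightarrow> ('g \<Rightarrow> 'e) \<Rightarrow> 'g \<Rightarrow> 'e \<Rightarrow> 'g tvector" where
  "chart_vector A U \<phi> p \<xi> =
     (\<lambda>f. if smooth_at A p f then frechet_derivative (f \<circ> inv_into U \<phi>) (at (\<phi> p)) \<xi> else 0)"

lemma tangent_space_eq:
  "tangent_space A p = {chart_vector A U \<phi> p \<xi> | U \<phi> \<xi>. (U, \<phi>) \<in> A \<and> p \<in> U}"
  unfolding tangent_space_def chart_vector_def by blast

lemma smooth_atI: "smooth_fun_on A S f \<Longrightarrow> p \<in> S \<Longrightarrow> smooth_at A p f"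
  unfolding smooth_at_def by blast

lemma smooth_vfields_tangent: "X \<in> smooth_vfields A \<Longrightarrow> X p \<in> tangent_space A p"
  unfolding smooth_vfields_def by blast

lemma smooth_at_vf_apply:
  "X \<in> smooth_vfields A \<Longrightarrow> smooth_at A p f \<Longrightarrow> smooth_at A p (vf_apply X f)"
  unfolding smooth_vfields_def smooth_at_def by blast

section \<open>Charts, smooth functions and tangent vectors on a manifold\<close>

locale smooth_manifold =
  fixes A :: "('g::topological_space, 'e::euclidean_space) chart set"
  assumes atlas: "smooth_atlas A"
begin

lemma chart_homeomorphism:
  assumes "(U, \<phi>) \<in> A"
  shows "open U" "open (\<phi> ` U)" "homeomorphism U (\<phi> ` U) \<phi> (inv_into U \<phi>)"
  using atlas assms unfolding smooth_atlas_def is_chart_def by auto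

lemma chart_inv [simp]:
  assumes "(U, \<phi>) \<in> A"
  shows "p \<in> U \<Longrightarrow> inv_into U \<phi> (\<phi> p) = p"
  using chart_homeomorphism(3)[OF assms] unfolding homeomorphism_def by auto

lemma continuous_on_chart_inv: "(U, \<phi>) \<in> A \<Longrightarrow> continuous_on (\<phi> ` U) (inv_into U \<phi>)"
  using chart_homeomorphism(3) unfolding homeomorphism_def by auto

lemma chart_at:
  obtains U \<phi> where "(U, \<phi>) \<in> A" "p \<in> U"
  using atlas unfolding smooth_atlas_def by blast

lemma chart_image_Int: "(U, \<phi>) \<in> A \<Longrightarrow> \<phi> ` (U \<inter> S) = {x \<in> \<phi> ` U. inv_into U \<phi> x \<in> S}"
  by (auto simp: image_iff)

lemma open_chart_image:
  assumes "(U, \<phi>) \<in> A" "open S"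
  shows "open (\<phi> ` (U \<inter> S))"
  using continuous_open_preimage[OF continuous_on_chart_inv[OF assms(1)]
      chart_homeomorphism(2)[OF assms(1)] assms(2)]
  unfolding chart_image_Int[OF assms(1)] by (simp add: vimage_def Int_def)

lemma smooth_on_chart:
  "smooth_fun_on A S f \<Longrightarrow> (U, \<phi>) \<in> A \<Longrightarrow> smooth_on (\<phi> ` (U \<inter> S)) (\<lambda>x. f (inv_into U \<phi> x))"
  unfolding smooth_fun_on_def by (auto simp: o_def)

lemma smooth_fun_onI:
  assumes "open S" "\<And>U \<phi>. (U, \<phi>) \<in> A \<Longrightarrow> smooth_on (\<phi> ` (U \<inter> S)) (\<lambda>x. f (inv_into U \<phi> x))"
  shows "smooth_fun_on A S f"
  using assms unfolding smooth_fun_on_def by (auto simp: o_def)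

lemma smooth_fun_on_openD: "smooth_fun_on A S f \<Longrightarrow> open S"
  unfolding smooth_fun_on_def by blast

lemma smooth_fun_on_subset: "smooth_fun_on A S f \<Longrightarrow> T \<subseteq> S \<Longrightarrow> open T \<Longrightarrow> smooth_fun_on A T f"
  by (rule smooth_fun_onI) (assumption, erule smooth_on_subset[OF smooth_on_chart], auto)

lemma smooth_fun_on_add:
  assumes "smooth_fun_on A S f" "smooth_fun_on A S h"
  shows "smooth_fun_on A S (\<lambda>q. f q + h q)"
  by (intro smooth_fun_onI smooth_on_add smooth_on_chart[OF assms(1)] smooth_on_chart[OF assms(2)]
      open_chart_image smooth_fun_on_openD[OF assms(1)])

lemma smooth_fun_on_diff:
  assumes "smooth_fun_on A S f" "smooth_fun_on A S h"
  shows "smooth_fun_on A S (\<lambda>q. f q - h q)"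
  by (intro smooth_fun_onI smooth_on_diff smooth_on_chart[OF assms(1)] smooth_on_chart[OF assms(2)]
      open_chart_image smooth_fun_on_openD[OF assms(1)])

lemma smooth_fun_on_cmult:
  assumes "smooth_fun_on A S f"
  shows "smooth_fun_on A S (\<lambda>q. c * f q)"
proof (rule smooth_fun_onI[OF smooth_fun_on_openD[OF assms]])
  fix U \<phi> assume U: "(U, \<phi>) \<in> A"
  show "smooth_on (\<phi> ` (U \<inter> S)) (\<lambda>x. c * f (inv_into U \<phi> x))"
    by (rule smooth_on_compose[OF open_chart_image[OF U smooth_fun_on_openD[OF assms]] open_UNIV
          subset_UNIV smooth_on_chart[OF assms U]
          smooth_on_bounded_linear[OF bounded_linear_mult_right[of c]]])
qed

lemma smooth_at_add:
  assumes "smooth_at A p f" "smooth_at A p h"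
  shows "smooth_at A p (\<lambda>q. f q + h q)"
proof -
  from assms obtain S T where S: "smooth_fun_on A S f" "p \<in> S" and T: "smooth_fun_on A T h" "p \<in> T"
    unfolding smooth_at_def by blast
  have "open (S \<inter> T)" using S T smooth_fun_on_openD by blast
  then have "smooth_fun_on A (S \<inter> T) (\<lambda>q. f q + h q)"
    using smooth_fun_on_subset[OF S(1), of "S \<inter> T"] smooth_fun_on_subset[OF T(1), of "S \<inter> T"]
    by (intro smooth_fun_on_add) auto
  then show ?thesis using S T by (auto intro: smooth_atI)
qed

lemma smooth_at_cmult: "smooth_at A p f \<Longrightarrow> smooth_at A p (\<lambda>q. c * f q)"
  unfolding smooth_at_def using smooth_fun_on_cmult by blast

lemma smooth_at_differentiable:
  assumes "smooth_at A p f" "(U, \<phi>) \<in> A" "p \<in> U"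
  shows "(f \<circ> inv_into U \<phi>) differentiable (at (\<phi> p))"
proof -
  from assms(1) obtain S where "smooth_fun_on A S f" "p \<in> S"
    unfolding smooth_at_def by blast
  with smooth_on_chart[OF this(1) assms(2)] assms(3) show ?thesis
    by (auto intro: smooth_on_imp_differentiable simp: o_def)
qed

lemma chart_vector_add:
  assumes "(U, \<phi>) \<in> A" "p \<in> U"
  shows "chart_vector A U \<phi> p (\<xi> + \<eta>) f = chart_vector A U \<phi> p \<xi> f + chart_vector A U \<phi> p \<eta> f"
  using linear_add[OF linear_frechet_derivative[OF smooth_at_differentiable[OF _ assms]]]
  by (simp add: chart_vector_def)

lemma chart_vector_scale:
  assumes "(U, \<phi>) \<in> A" "p \<in> U"
  shows "chart_vector A U \<phi> p (c *\<^sub>R \<xi>) f = c * chart_vector A U \<phi> p \<xi> f"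
  using linear_scale[OF linear_frechet_derivative[OF smooth_at_differentiable[OF _ assms]]]
  by (simp add: chart_vector_def)

lemma tangent_add:
  assumes "v \<in> tangent_space A p" "smooth_at A p f" "smooth_at A p h"
  shows "v (\<lambda>q. f q + h q) = v f + v h"
proof -
  from assms(1) obtain U \<phi> \<xi> where v: "v = chart_vector A U \<phi> p \<xi>" "(U, \<phi>) \<in> A" "p \<in> U"
    unfolding tangent_space_eq by blast
  note d = smooth_at_differentiable[OF _ v(2,3), unfolded frechet_derivative_works]
  from frechet_derivative_at[OF has_derivative_add[OF d[OF assms(2)] d[OF assms(3)]]]
  show ?thesis
    using assms(2,3) smooth_at_add[OF assms(2,3)] by (simp add: v chart_vector_def o_def fun_eq_iff)
qed

lemma tangent_cmult:
  assumes "v \<in> tangent_space A p" "smooth_at A p f"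
  shows "v (\<lambda>q. c * f q) = c * v f"
proof -
  from assms(1) obtain U \<phi> \<xi> where v: "v = chart_vector A U \<phi> p \<xi>" "(U, \<phi>) \<in> A" "p \<in> U"
    unfolding tangent_space_eq by blast
  note d = smooth_at_differentiable[OF assms(2) v(2,3), unfolded frechet_derivative_works]
  from frechet_derivative_at[OF has_derivative_mult_right[OF d]]
  show ?thesis
    using assms(2) smooth_at_cmult[OF assms(2)] by (simp add: v chart_vector_def o_def fun_eq_iff)
qed

lemma tangent_const:
  assumes "v \<in> tangent_space A p"
  shows "v (\<lambda>q. c) = 0"
  using assms by (auto simp: tangent_space_def o_def frechet_derivative_const)

end

section \<open>Left translations and the Lie bracket of left-invariant fields\<close>

locale lie_group_manifold =
  fixes A :: "('g::{topological_group_add, t2_space, second_countable_topology},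
               'e::euclidean_space) chart set"
  assumes lie_group: "lie_group A"
begin

sublocale smooth_manifold A
  using lie_group by unfold_locales (simp add: lie_group_def)

lemma open_mult_domain:
  assumes "(U, \<phi>) \<in> A" "(V, \<psi>) \<in> A" "open W"
  shows "open {(x, y). x \<in> \<phi> ` U \<and> y \<in> \<psi> ` V \<and> inv_into U \<phi> x + inv_into V \<psi> y \<in> W}" (is "open ?S")
proof -
  have "continuous_on (\<phi> ` U \<times> \<psi> ` V) (\<lambda>z. inv_into U \<phi> (fst z) + inv_into V \<psi> (snd z))"
    by (intro continuous_on_add continuous_on_compose2[OF continuous_on_chart_inv[OF assms(1)]]
        continuous_on_compose2[OF continuous_on_chart_inv[OF assms(2)]] continuous_intros) auto
  from continuous_open_preimage[OF this open_Times[OF chart_homeomorphism(2)[OF assms(1)]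
        chart_homeomorphism(2)[OF assms(2)]] assms(3)]
  show ?thesis by (rule back_subst[where P = "open"]) auto
qed

lemma smooth_on_mult:
  assumes "(U, \<phi>) \<in> A" "(V, \<psi>) \<in> A" "(W, \<theta>) \<in> A"
  shows "smooth_on {(x, y). x \<in> \<phi> ` U \<and> y \<in> \<psi> ` V \<and> inv_into U \<phi> x + inv_into V \<psi> y \<in> W}
    (\<lambda>(x, y). \<theta> (inv_into U \<phi> x + inv_into V \<psi> y))"
  using lie_group assms unfolding lie_group_def by blast

lemma open_left_preimage: "open S \<Longrightarrow> open {q. a + q \<in> (S :: 'g set)}"
  using continuous_open_vimage[of S "\<lambda>q. a + q"] by (simp add: vimage_def continuous_intros)

text \<open>Left translation by a is the slice of the smooth multiplication map at the fixed first
  coordinate \<theta> a, for a chart \<theta> around a.\<close>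

lemma smooth_on_left_mult:
  assumes "(U, \<phi>) \<in> A" "(V, \<psi>) \<in> A"
  shows "smooth_on (\<phi> ` (U \<inter> {q. a + q \<in> V})) (\<lambda>x. \<psi> (a + inv_into U \<phi> x))"
proof -
  obtain W \<theta> where W: "(W, \<theta>) \<in> A" "a \<in> W" by (rule chart_at)
  have "open (\<phi> ` (U \<inter> {q. a + q \<in> V}))"
    by (intro open_chart_image assms open_left_preimage chart_homeomorphism(1)[OF assms(2)])
  from smooth_on_compose[OF this open_mult_domain[OF W(1) assms(1) chart_homeomorphism(1)[OF assms(2)]]
      _ smooth_on_Pair_left[of _ "\<theta> a"] smooth_on_mult[OF W(1) assms]]
  show ?thesis using W assms(1) by (auto simp: image_subset_iff)
qed

lemma smooth_fun_on_left_mult: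
  assumes f: "smooth_fun_on A S f"
  shows "smooth_fun_on A {q. a + q \<in> S} (\<lambda>q. f (a + q))"
proof (rule smooth_fun_onI)
  note S = smooth_fun_on_openD[OF f]
  show "open {q. a + q \<in> S}" by (rule open_left_preimage[OF S])
  fix U \<phi> assume U: "(U, \<phi>) \<in> A"
  show "smooth_on (\<phi> ` (U \<inter> {q. a + q \<in> S})) (\<lambda>x. f (a + inv_into U \<phi> x))"
  proof (rule smooth_on_locally)
    fix x assume "x \<in> \<phi> ` (U \<inter> {q. a + q \<in> S})"
    then obtain p where p: "x = \<phi> p" "p \<in> U" "a + p \<in> S" by auto
    obtain V \<psi> where V: "(V, \<psi>) \<in> A" "a + p \<in> V" by (rule chart_at)
    \<comment> \<open>Near p the translated function factors through the chart \<psi> around a + p: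
      it is f in that chart composed with the translation in coordinates.\<close>
    let ?T = "\<phi> ` (U \<inter> {q. a + q \<in> V \<inter> S})"
    have T: "open ?T"
      by (intro open_chart_image U open_left_preimage open_Int S chart_homeomorphism(1)[OF V(1)])
    have "smooth_on ?T (\<lambda>x. f (inv_into V \<psi> (\<psi> (a + inv_into U \<phi> x))))"
    proof (rule smooth_on_compose[OF T open_chart_image[OF V(1) S] _ _ smooth_on_chart[OF f V(1)]])
      show "(\<lambda>x. \<psi> (a + inv_into U \<phi> x)) ` ?T \<subseteq> \<psi> ` (V \<inter> S)"
        using U by auto
      show "smooth_on ?T (\<lambda>x. \<psi> (a + inv_into U \<phi> x))"
        by (rule smooth_on_subset[OF smooth_on_left_mult[OF U V(1)]]) auto
    qed
    then have "smooth_on ?T (\<lambda>x. f (a + inv_into U \<phi> x))"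
      using U V by (subst (asm) smooth_on_cong[OF T]) auto
    moreover have "x \<in> ?T" using p V by auto
    ultimately show "\<exists>T. open T \<and> x \<in> T \<and> smooth_on T (\<lambda>x. f (a + inv_into U \<phi> x))"
      using T by blast
  qed
qed

text \<open>The converse is the first direction for the translation by - a. Both directions count,
  because tangent vectors are 0 on non-smooth functions and \<open>left_push\<close> has to respect
  this default.\<close>

lemma smooth_at_left_mult: "smooth_at A p (\<lambda>q. f (a + q)) \<longleftrightarrow> smooth_at A (a + p) f"
proof
  assume "smooth_at A (a + p) f"
  then obtain S where "a + p \<in> S" and S: "smooth_fun_on A S f"
    unfolding smooth_at_def by blast
  then show "smooth_at A p (\<lambda>q. f (a + q))"
    using smooth_atI[OF smooth_fun_on_left_mult[OF S, of a], of p] by simp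
next
  assume "smooth_at A p (\<lambda>q. f (a + q))"
  then obtain S where "p \<in> S" and S: "smooth_fun_on A S (\<lambda>q. f (a + q))"
    unfolding smooth_at_def by blast
  then show "smooth_at A (a + p) f"
    using smooth_atI[OF smooth_fun_on_left_mult[OF S, of "- a"], of "a + p"] by simp
qed

text \<open>Chain rule: in coordinates, the pushforward applies the derivative of the left
  translation to \<xi>.\<close>

lemma left_push_chart_vector:
  assumes U: "(U, \<phi>) \<in> A" "p \<in> U" and V: "(V, \<psi>) \<in> A" "a + p \<in> V"
  shows "left_push a (chart_vector A U \<phi> p \<xi>) = chart_vector A V \<psi> (a + p)
    (frechet_derivative (\<lambda>x. \<psi> (a + inv_into U \<phi> x)) (at (\<phi> p)) \<xi>)"
proof (rule ext)
  fix f
  let ?m = "\<lambda>x. \<psi> (a + inv_into U \<phi> x)"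
  let ?T = "\<phi> ` (U \<inter> {q. a + q \<in> V})"
  have T: "open ?T" "\<phi> p \<in> ?T"
    using U V by (auto intro!: open_chart_image open_left_preimage chart_homeomorphism(1)[OF V(1)])
  show "left_push a (chart_vector A U \<phi> p \<xi>) f = chart_vector A V \<psi> (a + p)
    (frechet_derivative ?m (at (\<phi> p)) \<xi>) f"
  proof (cases "smooth_at A (a + p) f")
    case True
    have m: "(?m has_derivative frechet_derivative ?m (at (\<phi> p))) (at (\<phi> p))"
      using smooth_on_imp_differentiable[OF smooth_on_left_mult[OF U(1) V(1)] T(2)]
      by (simp add: frechet_derivative_works)
    have "?m (\<phi> p) = \<psi> (a + p)" using U by simp
    then have "((f \<circ> inv_into V \<psi>) has_derivative frechet_derivative (f \<circ> inv_into V \<psi>) (at (\<psi> (a + p))))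
        (at (?m (\<phi> p)))"
      using smooth_at_differentiable[OF True V] by (simp add: frechet_derivative_works)
    from frechet_derivative_at[OF diff_chain_at[OF m this]]
    have "frechet_derivative (f \<circ> inv_into V \<psi> \<circ> ?m) (at (\<phi> p)) \<xi>
        = frechet_derivative (f \<circ> inv_into V \<psi>) (at (\<psi> (a + p))) (frechet_derivative ?m (at (\<phi> p)) \<xi>)"
      by (metis comp_apply)
    moreover have "frechet_derivative (f \<circ> inv_into V \<psi> \<circ> ?m) (at (\<phi> p))
        = frechet_derivative ((\<lambda>q. f (a + q)) \<circ> inv_into U \<phi>) (at (\<phi> p))"
      using U V by (intro frechet_derivative_cong_open[OF T]) auto
    ultimately show ?thesis
      using True by (simp add: left_push_def chart_vector_def smooth_at_left_mult)
  qed (simp add: left_push_def chart_vector_def smooth_at_left_mult)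
qed

lemma left_push_tangent: "v \<in> tangent_space A p \<Longrightarrow> left_push a v \<in> tangent_space A (a + p)"
  unfolding tangent_space_eq using left_push_chart_vector chart_at by (smt (verit, best) mem_Collect_eq)

text \<open>Translation by 0 is the identity, so \<open>left_push_chart_vector\<close> with a = 0
  rewrites v from its own chart into the prescribed one.\<close>

lemma tangent_in_chart:
  assumes "v \<in> tangent_space A p" "(V, \<psi>) \<in> A" "p \<in> V"
  obtains \<xi> where "v = chart_vector A V \<psi> p \<xi>"
proof -
  from assms(1) obtain U \<phi> \<xi> where v: "v = chart_vector A U \<phi> p \<xi>" "(U, \<phi>) \<in> A" "p \<in> U"
    unfolding tangent_space_eq by blast
  have "left_push 0 v = v" by (simp add: left_push_def)
  with left_push_chart_vector[OF v(2,3) assms(2), of 0 \<xi>] assms(3) v(1)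
  have "v = chart_vector A V \<psi> p (frechet_derivative (\<lambda>x. \<psi> (0 + inv_into U \<phi> x)) (at (\<phi> p)) \<xi>)"
    by simp
  then show ?thesis by (rule that)
qed

lemma tangent_space_add:
  assumes "u \<in> tangent_space A p" "v \<in> tangent_space A p"
  shows "(\<lambda>f. u f + v f) \<in> tangent_space A p"
proof -
  obtain U \<phi> where U: "(U, \<phi>) \<in> A" "p \<in> U" by (rule chart_at)
  obtain \<xi> \<eta> where "u = chart_vector A U \<phi> p \<xi>" "v = chart_vector A U \<phi> p \<eta>"
    using tangent_in_chart[OF _ U] assms by metis
  then have "(\<lambda>f. u f + v f) = chart_vector A U \<phi> p (\<xi> + \<eta>)"
    using chart_vector_add[OF U] by auto
  then show ?thesis using U unfolding tangent_space_eq by blast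
qed

lemma tangent_space_scale:
  assumes "u \<in> tangent_space A p"
  shows "(\<lambda>f. c * u f) \<in> tangent_space A p"
proof -
  obtain U \<phi> \<xi> where U: "(U, \<phi>) \<in> A" "p \<in> U" and "u = chart_vector A U \<phi> p \<xi>"
    using assms unfolding tangent_space_eq by blast
  then have "(\<lambda>f. c * u f) = chart_vector A U \<phi> p (c *\<^sub>R \<xi>)"
    using chart_vector_scale[OF U] by auto
  then show ?thesis using U unfolding tangent_space_eq by blast
qed

lemma smooth_vfields_diff:
  assumes "X \<in> smooth_vfields A" "Y \<in> smooth_vfields A"
  shows "vf_diff X Y \<in> smooth_vfields A"
proof -
  have "vf_diff X Y p \<in> tangent_space A p" for p
    using tangent_space_add[OF smooth_vfields_tangent[OF assms(1), of p]
        tangent_space_scale[OF smooth_vfields_tangent[OF assms(2), of p], of "-1"]]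
    by (simp add: vf_diff_def)
  moreover have "smooth_fun_on A S (vf_apply (vf_diff X Y) f)" if "smooth_fun_on A S f" for S f
    using smooth_fun_on_diff[of S "vf_apply X f" "vf_apply Y f"] assms that
    by (simp add: smooth_vfields_def vf_apply_def vf_diff_def)
  ultimately show ?thesis by (simp add: smooth_vfields_def)
qed

text \<open>Applying a left-invariant field commutes with precomposing by a translation, so both
  terms of the commutator translate alike.\<close>

lemma lie_bracket_left_invariant:
  assumes "X \<in> lie_algebra A" "Y \<in> lie_algebra A"
  shows "lie_bracket A X Y (a + p) = left_push a (lie_bracket A X Y p)"
proof -
  have inv: "X (a + q) f = X q (\<lambda>r. f (a + r))" "Y (a + q) f = Y q (\<lambda>r. f (a + r))" for q f
    using assms by (simp_all add: lie_algebra_def left_push_def)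
  show ?thesis
    by (simp add: fun_eq_iff left_push_def lie_bracket_def smooth_at_left_mult vf_apply_def inv)
qed

lemma lie_bracket_add_right:
  assumes "X \<in> smooth_vfields A" "Y \<in> smooth_vfields A" "Z \<in> smooth_vfields A"
  shows "lie_bracket A X (vf_add Y Z) = vf_add (lie_bracket A X Y) (lie_bracket A X Z)"
proof (intro ext)
  fix p f
  show "lie_bracket A X (vf_add Y Z) p f = vf_add (lie_bracket A X Y) (lie_bracket A X Z) p f"
  proof (cases "smooth_at A p f")
    case True
    have "X p (\<lambda>q. vf_apply Y f q + vf_apply Z f q) = X p (vf_apply Y f) + X p (vf_apply Z f)"
      by (rule tangent_add[OF smooth_vfields_tangent[OF assms(1)] smooth_at_vf_apply[OF assms(2) True]
            smooth_at_vf_apply[OF assms(3) True]])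
    then show ?thesis
      using True by (simp add: lie_bracket_def vf_add_def vf_apply_def)
  qed (simp add: lie_bracket_def vf_add_def)
qed

lemma lie_bracket_scale_right:
  assumes "X \<in> smooth_vfields A" "Y \<in> smooth_vfields A"
  shows "lie_bracket A X (\<lambda>p f. c * Y p f) = (\<lambda>p f. c * lie_bracket A X Y p f)"
proof (intro ext)
  fix p f
  show "lie_bracket A X (\<lambda>p f. c * Y p f) p f = c * lie_bracket A X Y p f"
  proof (cases "smooth_at A p f")
    case True
    have "X p (\<lambda>q. c * vf_apply Y f q) = c * X p (vf_apply Y f)"
      by (rule tangent_cmult[OF smooth_vfields_tangent[OF assms(1)] smooth_at_vf_apply[OF assms(2) True]])
    then show ?thesis
      using True by (simp add: lie_bracket_def vf_apply_def algebra_simps)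
  qed (simp add: lie_bracket_def)
qed

lemma lie_bracket_skew: "lie_bracket A X Y p f = - lie_bracket A Y X p f"
  by (simp add: lie_bracket_def)

end

section \<open>The Lie algebra as a copy of the model space\<close>

locale based_lie_group = lie_group_manifold A
  for A :: "('g::{topological_group_add, t2_space, second_countable_topology},
             'e::euclidean_space) chart set" +
  fixes U\<^sub>0 :: "'g set" and \<phi>\<^sub>0 :: "'g \<Rightarrow> 'e"
  assumes base_chart: "(U\<^sub>0, \<phi>\<^sub>0) \<in> A" "0 \<in> U\<^sub>0"
begin

text \<open>The left-invariant field whose value at the unit has coordinates \<xi> in the base
  chart. It makes \<open>'e\<close> a model of the Lie algebra.\<close>

definition left_field :: "'e \<Rightarrow> 'g vfield" where
  "left_field \<xi> = (\<lambda>p. left_push p (chart_vector A U\<^sub>0 \<phi>\<^sub>0 0 \<xi>))"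

lemma left_field_apply:
  "left_field \<xi> p f = (if smooth_at A p f
     then frechet_derivative (\<lambda>y. f (p + inv_into U\<^sub>0 \<phi>\<^sub>0 y)) (at (\<phi>\<^sub>0 0)) \<xi> else 0)"
  using smooth_at_left_mult[of 0 f p]
  by (simp add: left_field_def left_push_def chart_vector_def o_def)

lemma chart_vector_0_tangent: "chart_vector A U\<^sub>0 \<phi>\<^sub>0 0 \<xi> \<in> tangent_space A 0"
  unfolding tangent_space_eq using base_chart by blast

lemma left_field_tangent: "left_field \<xi> p \<in> tangent_space A p"
  using left_push_tangent[OF chart_vector_0_tangent, of p] by (simp add: left_field_def)

lemma left_push_left_field: "left_push a (left_field \<xi> p) = left_field \<xi> (a + p)"
  by (simp add: left_field_def left_push_def add.assoc)

text \<open>At p, the field sends f to the derivative of q \<mapsto> f (p + q) at the unit along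
  \<xi>. This is smooth in p because multiplication is smooth in p and q jointly.\<close>

lemma left_field_smooth: "left_field \<xi> \<in> smooth_vfields A"
proof -
  have "smooth_fun_on A S (vf_apply (left_field \<xi>) f)" if f: "smooth_fun_on A S f" for S f
  proof (rule smooth_fun_onI)
    show S: "open S" by (rule smooth_fun_on_openD[OF f])
    fix U \<phi> assume U: "(U, \<phi>) \<in> A"
    show "smooth_on (\<phi> ` (U \<inter> S)) (\<lambda>x. vf_apply (left_field \<xi>) f (inv_into U \<phi> x))"
    proof (rule smooth_on_locally)
      fix x assume "x \<in> \<phi> ` (U \<inter> S)"
      then obtain p where p: "x = \<phi> p" "p \<in> U" "p \<in> S" by auto
      obtain V \<psi> where V: "(V, \<psi>) \<in> A" "p \<in> V" by (rule chart_at)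
      let ?\<Omega> = "{(x, y). x \<in> \<phi> ` U \<and> y \<in> \<phi>\<^sub>0 ` U\<^sub>0 \<and> inv_into U \<phi> x + inv_into U\<^sub>0 \<phi>\<^sub>0 y \<in> V \<inter> S}"
      have \<Omega>: "open ?\<Omega>"
        by (intro open_mult_domain U base_chart open_Int S chart_homeomorphism(1)[OF V(1)])
      \<comment> \<open>Coordinate expression of (p, q) \<mapsto> f (p + q). The function to be
        shown smooth is its derivative along (0, \<xi>), restricted to the slice where q is the
        unit.\<close>
      define F where "F = (\<lambda>z. f (inv_into U \<phi> (fst z) + inv_into U\<^sub>0 \<phi>\<^sub>0 (snd z)))"
      have "smooth_on ?\<Omega> (\<lambda>z. f (inv_into V \<psi> ((\<lambda>(x, y). \<psi> (inv_into U \<phi> x + inv_into U\<^sub>0 \<phi>\<^sub>0 y)) z)))"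
      proof (rule smooth_on_compose[OF \<Omega> open_chart_image[OF V(1) S] _ _ smooth_on_chart[OF f V(1)]])
        show "smooth_on ?\<Omega> (\<lambda>(x, y). \<psi> (inv_into U \<phi> x + inv_into U\<^sub>0 \<phi>\<^sub>0 y))"
          by (rule smooth_on_subset[OF smooth_on_mult[OF U base_chart(1) V(1)]]) auto
      qed auto
      then have F: "smooth_on ?\<Omega> F"
        unfolding F_def using V by (subst (asm) smooth_on_cong[OF \<Omega>]) auto
      let ?T = "\<phi> ` (U \<inter> (V \<inter> S))"
      have T: "open ?T" by (intro open_chart_image U open_Int S chart_homeomorphism(1)[OF V(1)])
      have T\<Omega>: "(y, \<phi>\<^sub>0 0) \<in> ?\<Omega>" if "y \<in> ?T" for y
        using that U base_chart by auto
      have "smooth_on ?T (\<lambda>y. frechet_derivative F (at (y, \<phi>\<^sub>0 0)) (0, \<xi>))"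
        by (rule smooth_on_compose[OF T \<Omega> _ smooth_on_Pair_right smooth_on_frechet_derivative[OF F]])
          (rule image_subsetI, erule T\<Omega>)
      moreover have "frechet_derivative F (at (y, \<phi>\<^sub>0 0)) (0, \<xi>) = vf_apply (left_field \<xi>) f (inv_into U \<phi> y)"
        if y: "y \<in> ?T" for y
      proof -
        have "(F has_derivative frechet_derivative F (at (y, \<phi>\<^sub>0 0))) (at (y, \<phi>\<^sub>0 0))"
          using smooth_on_imp_differentiable[OF F T\<Omega>[OF y]] by (simp add: frechet_derivative_works)
        moreover have "((\<lambda>w. (y, w)) has_derivative (\<lambda>w. (0, w))) (at (\<phi>\<^sub>0 0))"
          by (intro derivative_eq_intros) auto
        ultimately have "((F \<circ> (\<lambda>w. (y, w))) has_derivative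
            (frechet_derivative F (at (y, \<phi>\<^sub>0 0)) \<circ> (\<lambda>w. (0, w)))) (at (\<phi>\<^sub>0 0))"
          by (intro diff_chain_at) auto
        from frechet_derivative_at[OF this]
        have "frechet_derivative F (at (y, \<phi>\<^sub>0 0)) (0, \<xi>)
            = frechet_derivative (\<lambda>w. f (inv_into U \<phi> y + inv_into U\<^sub>0 \<phi>\<^sub>0 w)) (at (\<phi>\<^sub>0 0)) \<xi>"
          by (simp add: F_def o_def fun_eq_iff)
        moreover have "smooth_at A (inv_into U \<phi> y) f"
          using y U by (auto intro!: smooth_atI[OF f])
        ultimately show ?thesis by (simp add: vf_apply_def left_field_apply)
      qed
      ultimately have "smooth_on ?T (\<lambda>x. vf_apply (left_field \<xi>) f (inv_into U \<phi> x))"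
        by (subst (asm) smooth_on_cong[OF T]) auto
      moreover have "x \<in> ?T" using p V by auto
      ultimately show "\<exists>T. open T \<and> x \<in> T \<and>
          smooth_on T (\<lambda>x. vf_apply (left_field \<xi>) f (inv_into U \<phi> x))"
        using T by blast
    qed
  qed
  then show ?thesis using left_field_tangent by (simp add: smooth_vfields_def)
qed

lemma left_field_lie_algebra: "left_field \<xi> \<in> lie_algebra A"
  using left_field_smooth left_push_left_field by (simp add: lie_algebra_def)

lemma left_field_add: "left_field (\<xi> + \<eta>) = vf_add (left_field \<xi>) (left_field \<eta>)"
  using chart_vector_add[OF base_chart] by (simp add: left_field_def left_push_def vf_add_def fun_eq_iff)

lemma left_field_scale: "left_field (c *\<^sub>R \<xi>) = (\<lambda>p f. c * left_field \<xi> p f)"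
  using chart_vector_scale[OF base_chart] by (simp add: left_field_def left_push_def fun_eq_iff)

text \<open>Evaluated on the coordinate functions of the base chart, the vector at the unit returns
  the coordinates of \<xi>.\<close>

lemma left_field_eq_0D:
  assumes "left_field \<xi> 0 = (\<lambda>f. 0)"
  shows "\<xi> = 0"
proof (rule euclidean_eqI)
  fix b :: 'e assume "b \<in> Basis"
  let ?f = "\<lambda>q. \<phi>\<^sub>0 q \<bullet> b"
  have U0: "open U\<^sub>0" by (rule chart_homeomorphism(1)[OF base_chart(1)])
  have "smooth_fun_on A U\<^sub>0 ?f"
  proof (rule smooth_fun_onI[OF U0])
    fix U \<phi> assume U: "(U, \<phi>) \<in> A"
    have "smooth_on (\<phi> ` (U \<inter> U\<^sub>0)) (\<phi>\<^sub>0 \<circ> inv_into U \<phi>)"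
      using atlas U base_chart(1) unfolding smooth_atlas_def by blast
    from smooth_on_compose[OF open_chart_image[OF U U0] open_UNIV subset_UNIV this
          smooth_on_bounded_linear[OF bounded_linear_inner_left[of b]]]
    show "smooth_on (\<phi> ` (U \<inter> U\<^sub>0)) (\<lambda>x. \<phi>\<^sub>0 (inv_into U \<phi> x) \<bullet> b)"
      by (simp add: o_def)
  qed
  then have "smooth_at A 0 ?f" using base_chart(2) by (rule smooth_atI)
  with assms have "frechet_derivative (\<lambda>y. \<phi>\<^sub>0 (inv_into U\<^sub>0 \<phi>\<^sub>0 y) \<bullet> b) (at (\<phi>\<^sub>0 0)) \<xi> = 0"
    using left_field_apply[of \<xi> 0 ?f] by simp
  moreover have "frechet_derivative (\<lambda>y. \<phi>\<^sub>0 (inv_into U\<^sub>0 \<phi>\<^sub>0 y) \<bullet> b) (at (\<phi>\<^sub>0 0))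
      = frechet_derivative (\<lambda>y. y \<bullet> b) (at (\<phi>\<^sub>0 0))"
    using base_chart
    by (intro frechet_derivative_cong_open[OF chart_homeomorphism(2)[OF base_chart(1)]]) auto
  moreover have "frechet_derivative (\<lambda>y. y \<bullet> b) (at (\<phi>\<^sub>0 0)) = (\<lambda>y. y \<bullet> b)"
    by (metis bounded_linear_imp_has_derivative bounded_linear_inner_left frechet_derivative_at)
  ultimately show "\<xi> \<bullet> b = 0 \<bullet> b" by simp
qed

lemma tangent_left_field:
  assumes "v \<in> tangent_space A p"
  obtains \<xi> where "v = left_field \<xi> p"
proof -
  have "left_push (- p) v \<in> tangent_space A 0"
    using left_push_tangent[OF assms, of "- p"] by simp
  then obtain \<xi> where "left_push (- p) v = chart_vector A U\<^sub>0 \<phi>\<^sub>0 0 \<xi>"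
    using tangent_in_chart[OF _ base_chart] by metis
  then have "left_push p (left_push (- p) v) = left_field \<xi> p" by (simp add: left_field_def)
  moreover have "left_push p (left_push (- p) v) = v" by (simp add: left_push_def)
  ultimately show ?thesis using that by metis
qed

text \<open>A left-invariant field is determined by its value at the unit, and every tangent vector
  there has coordinates in the base chart.\<close>

lemma lie_algebra_left_field:
  assumes "X \<in> lie_algebra A"
  obtains \<xi> where "X = left_field \<xi>"
proof -
  have "X 0 \<in> tangent_space A 0"
    using assms by (auto simp: lie_algebra_def intro: smooth_vfields_tangent)
  then obtain \<xi> where "X 0 = left_field \<xi> 0" by (rule tangent_left_field)
  then have "X (p + 0) = left_field \<xi> (p + 0)" for p
    using assms left_push_left_field[of p \<xi> 0] by (simp add: lie_algebra_def del: add_0_right)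
  then show ?thesis using that by auto
qed

lemma left_field_0: "left_field 0 = vf_zero"
  using left_field_scale[of 0 0] by (simp add: vf_zero_def)

lemma left_field_inject: "left_field \<xi> = left_field \<eta> \<longleftrightarrow> \<xi> = \<eta>"
proof
  assume *: "left_field \<xi> = left_field \<eta>"
  have "left_field (\<xi> + (-1) *\<^sub>R \<eta>) 0 = (\<lambda>f. 0)"
    unfolding left_field_add left_field_scale * by (simp add: vf_add_def)
  from left_field_eq_0D[OF this] show "\<xi> = \<eta>" by simp
qed simp

end

section \<open>Curvature in terms of structure constants\<close>

text \<open>Here \<open>c i j k\<close> stands for the inner product of \<open>[e\<^sub>i, e\<^sub>j]\<close> with \<open>e\<^sub>k\<close> in an orthonormal
  frame of left-invariant vector fields, and \<open>christoffel c x y z\<close> is Koszul's formula.\<close>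

definition christoffel :: "(nat \<Rightarrow> nat \<Rightarrow> nat \<Rightarrow> real) \<Rightarrow> nat \<Rightarrow> nat \<Rightarrow> nat \<Rightarrow> real" where
  "christoffel c x y z = (c x y z - c y z x + c z x y) / 2"

text \<open>The three products are the e_v-components of nabla_x nabla_y e_u, nabla_y nabla_x e_u
  and nabla_[x,y] e_u, with the inner derivative, respectively the bracket, expanded along
  e_k.\<close>

definition frame_curvature ::
  "nat \<Rightarrow> (nat \<Rightarrow> nat \<Rightarrow> nat \<Rightarrow> real) \<Rightarrow> nat \<Rightarrow> nat \<Rightarrow> nat \<Rightarrow> nat \<Rightarrow> real" where
  "frame_curvature n c x y u v =
     (\<Sum>k<n. christoffel c y u k * christoffel c x k v - christoffel c x u k * christoffel c y k v
        - c x y k * christoffel c k u v)"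

text \<open>Metric compatibility in components: \<open>christoffel c x y z\<close> is the inner
  product of nabla_x e_y with e_z.\<close>

lemma christoffel_skew:
  assumes "\<And>i j k. c i j k = - c j i k"
  shows "christoffel c x z y = - christoffel c x y z"
  using assms[of x z y] assms[of z y x] assms[of y x z] by (simp add: christoffel_def field_simps)

lemma frame_curvature_skew12:
  assumes "\<And>i j k. c i j k = - c j i k"
  shows "frame_curvature n c y x u v = - frame_curvature n c x y u v"
  unfolding frame_curvature_def sum_negf[symmetric]
  by (rule sum.cong[OF refl]) (use assms[of y x] in simp)

text \<open>By \<open>christoffel_skew\<close>, exchanging u and v swaps the first two products and
  negates the third.\<close>

lemma frame_curvature_skew34:
  assumes "\<And>i j k. c i j k = - c j i k"
  shows "frame_curvature n c x y v u = - frame_curvature n c x y u v"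
  unfolding frame_curvature_def sum_negf[symmetric]
proof (rule sum.cong[OF refl])
  fix k
  note s = christoffel_skew[of c, OF assms]
  show "christoffel c y v k * christoffel c x k u - christoffel c x v k * christoffel c y k u
      - c x y k * christoffel c k v u
    = - (christoffel c y u k * christoffel c x k v - christoffel c x u k * christoffel c y k v
      - c x y k * christoffel c k u v)"
    unfolding s[of y v k] s[of x k u] s[of x v k] s[of y k u] s[of k v u] by (simp add: algebra_simps)
qed

section \<open>The curvature gap in dimension five\<close>

lemma sum_lessThan_5: "(\<Sum>i<5. f i) = f 0 + f 1 + f 2 + f 3 + f (4::nat)" for f :: "nat \<Rightarrow> real"
  by (simp add: eval_nat_numeral)

lemma sum_sum_lessThan_5_symmetric:
  fixes f :: "nat \<Rightarrow> nat \<Rightarrow> real"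
  assumes "\<And>x y. f x y = f y x" and "\<And>x. f x x = 0"
  shows "(\<Sum>x<5. \<Sum>y<5. f x y) =
    2 * (f 0 1 + f 0 2 + f 0 3 + f 0 4 + f 1 2 + f 1 3 + f 1 4 + f 2 3 + f 2 4 + f 3 4)"
  using assms(1)[of 1 0] assms(1)[of 2 0] assms(1)[of 3 0] assms(1)[of 4 0] assms(1)[of 2 1]
    assms(1)[of 3 1] assms(1)[of 4 1] assms(1)[of 3 2] assms(1)[of 4 2] assms(1)[of 4 3]
  by (simp add: sum_lessThan_5 assms(2))

text \<open>By Cauchy--Schwarz and AM--GM the form is at least
  \<open>5 S\<^sup>2 - 10 S M + 11 M\<^sup>2 + 11 J\<^sup>2 - 6 J M - 7 S J\<close>, which is positive definite in \<open>S\<close>, \<open>M\<close>, \<open>J\<close>.\<close>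

lemma curvature_gap_form_pos:
  fixes a b c d e f g h i j :: real
  defines "S \<equiv> a\<^sup>2 + b\<^sup>2 + c\<^sup>2 + d\<^sup>2 + e\<^sup>2 + f\<^sup>2" and "M \<equiv> g\<^sup>2 + h\<^sup>2 + i\<^sup>2" and "J \<equiv> j\<^sup>2"
  assumes nz: "S \<noteq> 0 \<or> M \<noteq> 0 \<or> J \<noteq> 0"
  shows "6 * (a\<^sup>2 + b\<^sup>2 + c\<^sup>2 + d\<^sup>2 + e\<^sup>2 + f\<^sup>2)\<^sup>2 + 10 * (a * i - b * h + c * g)\<^sup>2
      + 18 * (d * g + e * h + f * i)\<^sup>2 - 7 * (a\<^sup>2 + b\<^sup>2 + c\<^sup>2) * (g\<^sup>2 + h\<^sup>2 + i\<^sup>2)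
      - (d\<^sup>2 + e\<^sup>2 + f\<^sup>2) * (g\<^sup>2 + h\<^sup>2 + i\<^sup>2) + 11 * (g\<^sup>2 + h\<^sup>2 + i\<^sup>2)\<^sup>2 + 11 * j^4
      + j\<^sup>2 * (- 2 * g\<^sup>2 - 2 * h\<^sup>2 + 22 * i\<^sup>2)
      + j\<^sup>2 * (3 * a\<^sup>2 - b\<^sup>2 - c\<^sup>2 - 7 * d\<^sup>2 - 7 * e\<^sup>2 + 17 * f\<^sup>2)
      + 14 * j * (a * (d * h - e * g) + f * (b * g + c * h)) - 12 * i * j * (b * d + c * e) > 0"
    (is "?Q > 0")
proof -
  \<comment> \<open>The grouping follows the terms with j, which weigh a, the pair b and c, the pair
    d and e, and f differently, and likewise the pair g and h against i.\<close>
  define A B D F m I where "A = a\<^sup>2" and "B = b\<^sup>2 + c\<^sup>2" and "D = d\<^sup>2 + e\<^sup>2" and "F = f\<^sup>2"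
    and "m = g\<^sup>2 + h\<^sup>2" and "I = i\<^sup>2"
  note defs = A_def B_def D_def F_def m_def I_def S_def M_def J_def
  have SM: "S = A + B + D + F" "M = m + I" by (simp_all add: defs)
  have nn: "A \<ge> 0" "B \<ge> 0" "D \<ge> 0" "F \<ge> 0" "m \<ge> 0" "I \<ge> 0" "J \<ge> 0" by (simp_all add: defs)
  let ?u = "d * h - e * g" and ?w = "b * g + c * h" and ?z = "b * d + c * e"
  define p\<^sub>1 p\<^sub>2 p\<^sub>3 p\<^sub>4 p\<^sub>5
    \<comment> \<open>Completed squares for the terms of indefinite sign. The coefficient 14 of a j
      (d h - e g) is split as 6 + 8: the first part spends exactly the available 3 A J and costs 3
      u, the second costs 4 A D + 4 J m. The fractions 7/17 and 3/11 complete the squares that start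
      from 17 F J and 22 I J.\<close>
    where "p\<^sub>1 = 3 * (a * j + ?u)\<^sup>2 + 4 * ((a * d + j * h)\<^sup>2 + (a * e - j * g)\<^sup>2)"
    and "p\<^sub>2 = 17 * (f * j + 7 / 17 * ?w)\<^sup>2" and "p\<^sub>3 = 22 * (i * j - 3 / 11 * ?z)\<^sup>2"
    and "p\<^sub>4 = 10 * (a * i - b * h + c * g)\<^sup>2" and "p\<^sub>5 = 18 * (d * g + e * h + f * i)\<^sup>2"
  define u w z where "u = ?u\<^sup>2" and "w = ?w\<^sup>2" and "z = ?z\<^sup>2"
  have u: "u \<le> D * m" and w: "w \<le> B * m" "0 \<le> w" and z: "z \<le> B * D" "0 \<le> z"
  proof -
    \<comment> \<open>Lagrange's identity in the plane: Cauchy-Schwarz together with its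
      defect.\<close>
    have "D * m = u + (d * g + e * h)\<^sup>2" "B * m = w + (b * h - c * g)\<^sup>2"
      "B * D = z + (b * e - c * d)\<^sup>2"
      unfolding u_def w_def z_def defs by algebra+
    then show "u \<le> D * m" "w \<le> B * m" "z \<le> B * D" "0 \<le> w" "0 \<le> z"
      by (simp_all add: w_def z_def)
  qed
  have p: "p\<^sub>1 \<ge> 0" "p\<^sub>2 \<ge> 0" "p\<^sub>3 \<ge> 0" "p\<^sub>4 \<ge> 0" "p\<^sub>5 \<ge> 0"
    by (simp_all add: p\<^sub>1_def p\<^sub>2_def p\<^sub>3_def p\<^sub>4_def p\<^sub>5_def)
  define t\<^sub>1 t\<^sub>2 t\<^sub>3 where "t\<^sub>1 = 14 * j * (a * ?u)" and "t\<^sub>2 = 17 * (F * J) + 14 * j * (f * ?w)"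
    and "t\<^sub>3 = 22 * (I * J) - 12 * i * j * ?z"
  have "t\<^sub>1 = p\<^sub>1 - 3 * (A * J) - 3 * u - 4 * (A * D) - 4 * (J * m)"
    unfolding defs t\<^sub>1_def p\<^sub>1_def u_def by algebra
  then have 1: "t\<^sub>1 \<ge> - 3 * (A * J) - 3 * (D * m) - 4 * (A * D) - 4 * (J * m)"
    using u p by linarith
  have "t\<^sub>2 = p\<^sub>2 - 49 / 17 * w"
    by (simp add: defs t\<^sub>2_def p\<^sub>2_def w_def power2_eq_square algebra_simps)
  \<comment> \<open>The constants are rounded up to integers: 49/17 to 3 here, 18/11 to 2
    below.\<close>
  then have 2: "t\<^sub>2 \<ge> - 3 * (B * m)"
    using w nn p by linarith
  have "t\<^sub>3 = p\<^sub>3 - 18 / 11 * z"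
    by (simp add: defs t\<^sub>3_def p\<^sub>3_def z_def power2_eq_square algebra_simps)
  then have 3: "t\<^sub>3 \<ge> - 2 * (B * D)"
    using z p by linarith
  have "?Q = 6 * S\<^sup>2 + p\<^sub>4 + p\<^sub>5
      - 7 * ((A + B) * M) - (D + F) * M + 11 * M\<^sup>2 + 11 * J\<^sup>2 - 2 * (J * m) + 3 * (A * J) - B * J - 7 * (D * J)
      + t\<^sub>1 + t\<^sub>2 + t\<^sub>3"
    unfolding defs p\<^sub>4_def p\<^sub>5_def t\<^sub>1_def t\<^sub>2_def t\<^sub>3_def by algebra
  also have "\<dots> \<ge> 6 * S\<^sup>2 - 7 * ((A + B) * M) - (D + F) * M + 11 * M\<^sup>2 + 11 * J\<^sup>2 - 6 * (J * m)
      - B * J - 7 * (D * J) - 3 * (D * m) - 4 * (A * D) - 3 * (B * m) - 2 * (B * D)"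
    using 1 2 3 p by linarith
  finally have "?Q \<ge> 6 * S\<^sup>2 - 7 * ((A + B) * M) - (D + F) * M + 11 * M\<^sup>2 + 11 * J\<^sup>2 - 6 * (J * m)
      - B * J - 7 * (D * J) - 3 * (D * m) - 4 * (A * D) - 3 * (B * m) - 2 * (B * D)" .
  \<comment> \<open>One of the six copies of S^2 is reserved for - 4 A D - 2 B D. The coefficients
    -10, -6, -7 of the form in S, M, J are dictated by the worst terms, those in B m, J m and D J;
    all other products are then left with nonnegative coefficients.\<close>
  moreover have "6 * S\<^sup>2 - 7 * ((A + B) * M) - (D + F) * M + 11 * M\<^sup>2 + 11 * J\<^sup>2 - 6 * (J * m)
      - B * J - 7 * (D * J) - 3 * (D * m) - 4 * (A * D) - 3 * (B * m) - 2 * (B * D)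
    = 5 * S\<^sup>2 - 10 * (S * M) + 11 * M\<^sup>2 + 11 * J\<^sup>2 - 6 * (J * M) - 7 * (S * J)
      + (S\<^sup>2 - 4 * (A * D) - 2 * (B * D)) + (3 * (A * M) + 9 * (F * M) + 6 * (J * I)
      + 3 * (B * I) + 6 * (D * m) + 9 * (D * I)) + (7 * (A * J) + 6 * (B * J) + 7 * (F * J))"
    unfolding SM by algebra
  moreover have "S\<^sup>2 - 4 * (A * D) - 2 * (B * D) \<ge> 0"
  proof -
    \<comment> \<open>The square of A + B - D pays for 4 (A + B) D, which is 2 B D more than
      required.\<close>
    have "S\<^sup>2 - 4 * (A * D) - 2 * (B * D) = (A + B - D)\<^sup>2 + 2 * (B * D) + F * (F + 2 * (A + B + D))"
      unfolding SM by algebra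
    then show ?thesis using nn by simp
  qed
  moreover have "3 * (A * M) + 9 * (F * M) + 6 * (J * I) + 3 * (B * I) + 6 * (D * m) + 9 * (D * I) \<ge> 0"
    "7 * (A * J) + 6 * (B * J) + 7 * (F * J) \<ge> 0"
    using nn unfolding SM by simp_all
  moreover have "5 * S\<^sup>2 - 10 * (S * M) + 11 * M\<^sup>2 + 11 * J\<^sup>2 - 6 * (J * M) - 7 * (S * J) > 0"
  proof -
    \<comment> \<open>Squares are completed in the order S, M, J; the rest is 181/120 = 11 - 5
      (7/10)^2 - 6 (13/12)^2.\<close>
    have eq: "5 * S\<^sup>2 - 10 * (S * M) + 11 * M\<^sup>2 + 11 * J\<^sup>2 - 6 * (J * M) - 7 * (S * J)
        = 5 * (S - M - 7 / 10 * J)\<^sup>2 + 6 * (M - 13 / 12 * J)\<^sup>2 + (181 / 120) * J\<^sup>2"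
      by (simp add: power2_eq_square algebra_simps)
    show ?thesis
    proof (cases "J = 0")
      case False
      then have "J\<^sup>2 > 0" by simp
      then show ?thesis unfolding eq
        using zero_le_power2[of "S - M - 7 / 10 * J"] zero_le_power2[of "M - 13 / 12 * J"] by linarith
    next
      case True
      then have "(S - M)\<^sup>2 > 0 \<or> M\<^sup>2 > 0" using nz by auto
      then show ?thesis unfolding eq using True
        by (auto intro: add_pos_nonneg add_nonneg_pos)
    qed
  qed
  ultimately show ?thesis by linarith
qed

text \<open>With components scaled by 4, both sides become polynomials in the ten constants
  \<open>C i j k\<close> with k < i < j < 5, and their difference is four times the form of
  \<open>curvature_gap_form_pos\<close>. In geometric terms, the central direction carries less than
  a fifth of |R|^2.\<close>

lemma frame_curvature_gap:
  fixes C :: "nat \<Rightarrow> nat \<Rightarrow> nat \<Rightarrow> real"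
  assumes skew: "\<And>i j k. C i j k = - C j i k"
    and zero: "\<And>i j k. i \<le> k \<or> j \<le> k \<Longrightarrow> C i j k = 0"
    and bound: "\<And>i j k. 5 \<le> i \<Longrightarrow> C i j k = 0"
    and nz: "C i\<^sub>0 j\<^sub>0 k\<^sub>0 \<noteq> 0"
  shows "5 * (\<Sum>x<5. \<Sum>y<5. \<Sum>z<5. (frame_curvature 5 C 0 x y z)\<^sup>2)
    < (\<Sum>i<5. \<Sum>x<5. \<Sum>y<5. \<Sum>z<5. (frame_curvature 5 C i x y z)\<^sup>2)"
proof -
  define a b c d e f g h i j where "a = C 1 2 0" and "b = C 1 3 0" and "c = C 1 4 0" and "d = C 2 3 0"
    and "e = C 2 4 0" and "f = C 3 4 0" and "g = C 2 3 1" and "h = C 2 4 1" and "i = C 3 4 1"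
    and "j = C 3 4 2"
  have tab: "C 1 2 0 = a" "C 1 3 0 = b" "C 1 4 0 = c" "C 2 3 0 = d" "C 2 4 0 = e" "C 3 4 0 = f"
    "C 2 3 1 = g" "C 2 4 1 = h" "C 3 4 1 = i" "C 3 4 2 = j"
    "C 2 1 0 = - a" "C 3 1 0 = - b" "C 4 1 0 = - c" "C 3 2 0 = - d" "C 4 2 0 = - e" "C 4 3 0 = - f"
    "C 3 2 1 = - g" "C 4 2 1 = - h" "C 4 3 1 = - i" "C 4 3 2 = - j"
    unfolding a_def b_def c_def d_def e_def f_def g_def h_def i_def j_def by (rule refl skew)+
  have diag: "C i i k = 0" for i k using skew[of i i k] by simp
  note [simp] = zero diag tab tab[unfolded One_nat_def]
  \<comment> \<open>The factor 4 clears the halves in \<open>christoffel\<close>.\<close>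
  define R where "R x y u v = 4 * frame_curvature 5 C x y u v" for x y u v
  have skew12: "R y x u v = - R x y u v" for x y u v
    unfolding R_def using frame_curvature_skew12[of C 5 y x u v, OF skew] by simp
  have skew34: "R x y v u = - R x y u v" for x y u v
    unfolding R_def using frame_curvature_skew34[of C 5 x y v u, OF skew] by simp
  have R_eq: "R x y u v = (\<Sum>k<5. (C y u k - C u k y + C k y u) * (C x k v - C k v x + C v x k)
      - (C x u k - C u k x + C k x u) * (C y k v - C k v y + C v y k)
      - 2 * C x y k * (C k u v - C u v k + C v k u))" for x y u v
    unfolding R_def frame_curvature_def christoffel_def sum_distrib_left
    by (rule sum.cong[OF refl]) (simp add: field_simps)
  \<comment> \<open>The tables are sorted by the first index pair. For a general skew array C,
    exchanging the pairs is not a symmetry: \<open>R 0 3 1 4\<close> and \<open>R 1 4 0 3\<close>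
    differ by 2 a j, and \<open>R 0 4 2 3\<close> and \<open>R 2 3 0 4\<close> by 2 (a i - b h + c
    g), where a j and a i - b h + c g are the Jacobi expressions. Hence all hundred entries are
    listed.\<close>
  have R01: "R 0 1 0 1 = - a\<^sup>2 - b\<^sup>2 - c\<^sup>2"
    "R 0 1 0 2 = - b * d - c * e"
    "R 0 1 0 3 = a * d - c * f"
    "R 0 1 0 4 = a * e + b * f"
    "R 0 1 1 2 = b * g + c * h"
    "R 0 1 1 3 = c * i - a * g"
    "R 0 1 1 4 = - a * h - b * i"
    "R 0 1 2 3 = e * i - f * h"
    "R 0 1 2 4 = f * g - d * i"
    "R 0 1 3 4 = d * h - e * g"
    by (simp_all add: R_eq sum_lessThan_5 power2_eq_square algebra_simps)
  have R02: "R 0 2 0 1 = - b * d - c * e"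
    "R 0 2 0 2 = - a\<^sup>2 - d\<^sup>2 - e\<^sup>2"
    "R 0 2 0 3 = - a * b - e * f"
    "R 0 2 0 4 = d * f - a * c"
    "R 0 2 1 2 = - d * g - e * h"
    "R 0 2 1 3 = c * j - f * h"
    "R 0 2 1 4 = f * g - b * j"
    "R 0 2 2 3 = a * g + e * j"
    "R 0 2 2 4 = a * h - d * j"
    "R 0 2 3 4 = b * h - c * g"
    by (simp_all add: R_eq sum_lessThan_5 power2_eq_square algebra_simps)
  have R03: "R 0 3 0 1 = a * d - c * f"
    "R 0 3 0 2 = - a * b - e * f"
    "R 0 3 0 3 = - b\<^sup>2 - d\<^sup>2 - f\<^sup>2"
    "R 0 3 0 4 = - b * c - d * e"
    "R 0 3 1 2 = c * j - e * i"
    "R 0 3 1 3 = - d * g - f * i"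
    "R 0 3 1 4 = - a * j - e * g"
    "R 0 3 2 3 = b * g - f * j"
    "R 0 3 2 4 = a * i + c * g"
    "R 0 3 3 4 = b * i + d * j"
    by (simp_all add: R_eq sum_lessThan_5 power2_eq_square algebra_simps)
  have R04: "R 0 4 0 1 = a * e + b * f"
    "R 0 4 0 2 = d * f - a * c"
    "R 0 4 0 3 = - b * c - d * e"
    "R 0 4 0 4 = - c\<^sup>2 - e\<^sup>2 - f\<^sup>2"
    "R 0 4 1 2 = d * i - b * j"
    "R 0 4 1 3 = a * j - d * h"
    "R 0 4 1 4 = - e * h - f * i"
    "R 0 4 2 3 = b * h - a * i"
    "R 0 4 2 4 = c * h - f * j"
    "R 0 4 3 4 = c * i + e * j"
    by (simp_all add: R_eq sum_lessThan_5 power2_eq_square algebra_simps)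
  have R12: "R 1 2 0 1 = b * g + c * h"
    "R 1 2 0 2 = - d * g - e * h"
    "R 1 2 0 3 = c * j - e * i"
    "R 1 2 0 4 = d * i - b * j"
    "R 1 2 1 2 = 3 * a\<^sup>2 - g\<^sup>2 - h\<^sup>2"
    "R 1 2 1 3 = 3 * a * b - h * i"
    "R 1 2 1 4 = 3 * a * c + g * i"
    "R 1 2 2 3 = 3 * a * d + h * j"
    "R 1 2 2 4 = 3 * a * e - g * j"
    "R 1 2 3 4 = 2 * a * f + b * e - c * d"
    by (simp_all add: R_eq sum_lessThan_5 power2_eq_square algebra_simps)
  have R13: "R 1 3 0 1 = c * i - a * g"
    "R 1 3 0 2 = c * j - f * h"
    "R 1 3 0 3 = - d * g - f * i"
    "R 1 3 0 4 = - a * j - d * h"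
    "R 1 3 1 2 = 3 * a * b - h * i"
    "R 1 3 1 3 = 3 * b\<^sup>2 - g\<^sup>2 - i\<^sup>2"
    "R 1 3 1 4 = 3 * b * c - g * h"
    "R 1 3 2 3 = 3 * b * d - i * j"
    "R 1 3 2 4 = a * f + 2 * b * e + c * d"
    "R 1 3 3 4 = 3 * b * f + g * j"
    by (simp_all add: R_eq sum_lessThan_5 power2_eq_square algebra_simps)
  have R14: "R 1 4 0 1 = - a * h - b * i"
    "R 1 4 0 2 = f * g - b * j"
    "R 1 4 0 3 = a * j - e * g"
    "R 1 4 0 4 = - e * h - f * i"
    "R 1 4 1 2 = 3 * a * c + g * i"
    "R 1 4 1 3 = 3 * b * c - g * h"
    "R 1 4 1 4 = 3 * c\<^sup>2 - h\<^sup>2 - i\<^sup>2"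
    "R 1 4 2 3 = b * e + 2 * c * d - a * f"
    "R 1 4 2 4 = 3 * c * e - i * j"
    "R 1 4 3 4 = 3 * c * f + h * j"
    by (simp_all add: R_eq sum_lessThan_5 power2_eq_square algebra_simps)
  have R23: "R 2 3 0 1 = e * i - f * h"
    "R 2 3 0 2 = a * g + e * j"
    "R 2 3 0 3 = b * g - f * j"
    "R 2 3 0 4 = a * i + 2 * c * g - b * h"
    "R 2 3 1 2 = 3 * a * d + h * j"
    "R 2 3 1 3 = 3 * b * d - i * j"
    "R 2 3 1 4 = b * e + 2 * c * d - a * f"
    "R 2 3 2 3 = 3 * d\<^sup>2 + 3 * g\<^sup>2 - j\<^sup>2"
    "R 2 3 2 4 = 3 * d * e + 3 * g * h"
    "R 2 3 3 4 = 3 * d * f + 3 * g * i"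
    by (simp_all add: R_eq sum_lessThan_5 power2_eq_square algebra_simps)
  have R24: "R 2 4 0 1 = f * g - d * i"
    "R 2 4 0 2 = a * h - d * j"
    "R 2 4 0 3 = 2 * b * h - a * i - c * g"
    "R 2 4 0 4 = c * h - f * j"
    "R 2 4 1 2 = 3 * a * e - g * j"
    "R 2 4 1 3 = a * f + 2 * b * e + c * d"
    "R 2 4 1 4 = 3 * c * e - i * j"
    "R 2 4 2 3 = 3 * d * e + 3 * g * h"
    "R 2 4 2 4 = 3 * e\<^sup>2 + 3 * h\<^sup>2 - j\<^sup>2"
    "R 2 4 3 4 = 3 * e * f + 3 * h * i"
    by (simp_all add: R_eq sum_lessThan_5 power2_eq_square algebra_simps)
  have R34: "R 3 4 0 1 = d * h - 2 * a * j - e * g"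
    "R 3 4 0 2 = 2 * a * i + c * g - b * h"
    "R 3 4 0 3 = b * i + d * j"
    "R 3 4 0 4 = c * i + e * j"
    "R 3 4 1 2 = 2 * a * f + b * e - c * d"
    "R 3 4 1 3 = 3 * b * f + g * j"
    "R 3 4 1 4 = 3 * c * f + h * j"
    "R 3 4 2 3 = 3 * d * f + 3 * g * i"
    "R 3 4 2 4 = 3 * e * f + 3 * h * i"
    "R 3 4 3 4 = 3 * f\<^sup>2 + 3 * i\<^sup>2 + 3 * j\<^sup>2"
    by (simp_all add: R_eq sum_lessThan_5 power2_eq_square algebra_simps)
  have 2: "(\<Sum>u<5. \<Sum>v<5. (R x y u v)\<^sup>2) = 2 * ((R x y 0 1)\<^sup>2 + (R x y 0 2)\<^sup>2 + (R x y 0 3)\<^sup>2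
      + (R x y 0 4)\<^sup>2 + (R x y 1 2)\<^sup>2 + (R x y 1 3)\<^sup>2 + (R x y 1 4)\<^sup>2 + (R x y 2 3)\<^sup>2
      + (R x y 2 4)\<^sup>2 + (R x y 3 4)\<^sup>2)" for x y
  proof (rule sum_sum_lessThan_5_symmetric)
    show "(R x y u v)\<^sup>2 = (R x y v u)\<^sup>2" for u v
      unfolding skew34[of x y u v] by simp
    show "(R x y u u)\<^sup>2 = 0" for u
      using skew34[of x y u u] by simp
  qed
  define T where "T x y = (\<Sum>u<5. \<Sum>v<5. (R x y u v)\<^sup>2)" for x y
  have T1: "T x y = T y x" for x y
    unfolding T_def skew12[of x y] by simp
  have "R x x u v = 0" for x u v
    using skew12[of x x u v] by simp
  then have T2: "T x x = 0" for x
    by (simp add: T_def)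
  \<comment> \<open>Each T 0 y occurs twice in the full sum and five times in the subtracted one,
    hence the weight 2 - 5 = -3.\<close>
  have "(\<Sum>x<5. \<Sum>y<5. T x y) - 5 * (\<Sum>y<5. T 0 y)
      = (- 3) * (T 0 1 + T 0 2 + T 0 3 + T 0 4)
        + 2 * (T 1 2 + T 1 3 + T 1 4 + T 2 3 + T 2 4 + T 3 4)"
    unfolding sum_sum_lessThan_5_symmetric[of T, OF T1 T2] sum_lessThan_5[of "T 0"] T2 by simp
  also have "\<dots> = 4 * (6 * (a\<^sup>2 + b\<^sup>2 + c\<^sup>2 + d\<^sup>2 + e\<^sup>2 + f\<^sup>2)\<^sup>2 + 10 * (a * i - b * h + c * g)\<^sup>2
      + 18 * (d * g + e * h + f * i)\<^sup>2 - 7 * (a\<^sup>2 + b\<^sup>2 + c\<^sup>2) * (g\<^sup>2 + h\<^sup>2 + i\<^sup>2)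
      - (d\<^sup>2 + e\<^sup>2 + f\<^sup>2) * (g\<^sup>2 + h\<^sup>2 + i\<^sup>2) + 11 * (g\<^sup>2 + h\<^sup>2 + i\<^sup>2)\<^sup>2 + 11 * j^4
      + j\<^sup>2 * (- 2 * g\<^sup>2 - 2 * h\<^sup>2 + 22 * i\<^sup>2)
      + j\<^sup>2 * (3 * a\<^sup>2 - b\<^sup>2 - c\<^sup>2 - 7 * d\<^sup>2 - 7 * e\<^sup>2 + 17 * f\<^sup>2)
      + 14 * j * (a * (d * h - e * g) + f * (b * g + c * h)) - 12 * i * j * (b * d + c * e))"
    unfolding T_def 2 R01 R02 R03 R04 R12 R13 R14 R23 R24 R34 by algebra
  also have "\<dots> > 0"
  proof -
    have "a \<noteq> 0 \<or> b \<noteq> 0 \<or> c \<noteq> 0 \<or> d \<noteq> 0 \<or> e \<noteq> 0 \<or> f \<noteq> 0 \<or> g \<noteq> 0 \<or> h \<noteq> 0 \<or> i \<noteq> 0 \<or> j \<noteq> 0"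
    proof (rule ccontr)
      assume "\<not> ?thesis"
      then have 0: "a = 0" "b = 0" "c = 0" "d = 0" "e = 0" "f = 0" "g = 0" "h = 0" "i = 0" "j = 0"
        by auto
      have "\<not> 5 \<le> i\<^sub>0" "\<not> 5 \<le> j\<^sub>0" using bound nz skew[of i\<^sub>0 j\<^sub>0] by auto
      moreover have "k\<^sub>0 < i\<^sub>0" "k\<^sub>0 < j\<^sub>0" using zero nz by (meson not_less)+
      ultimately have "i\<^sub>0 \<in> {0, 1, 2, 3, 4}" "j\<^sub>0 \<in> {0, 1, 2, 3, 4}" "k\<^sub>0 \<in> {0, 1, 2, 3, 4}" by auto
      then show False using nz by (auto simp: 0)
    qed
    then have "a\<^sup>2 + b\<^sup>2 + c\<^sup>2 + d\<^sup>2 + e\<^sup>2 + f\<^sup>2 \<noteq> 0 \<or> g\<^sup>2 + h\<^sup>2 + i\<^sup>2 \<noteq> 0 \<or> j\<^sup>2 \<noteq> 0"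
      by (simp add: add_nonneg_eq_0_iff)
    from curvature_gap_form_pos[OF this] show ?thesis by simp
  qed
  finally have "5 * (\<Sum>y<5. T 0 y) < (\<Sum>x<5. \<Sum>y<5. T x y)" by simp
  then show ?thesis by (simp add: T_def R_def power_mult_distrib sum_distrib_left[symmetric])
qed

section \<open>Index raising in orthonormal frames, and padding to dimension five\<close>

lemma sum_lessThan_truncate:
  fixes f :: "nat \<Rightarrow> real"
  assumes "n \<le> m" "\<And>i. n \<le> i \<Longrightarrow> f i = 0"
  shows "(\<Sum>i<m. f i) = (\<Sum>i<n. f i)"
  using assms by (intro sum.mono_neutral_right) auto

lemma raise3_delta:
  assumes "a < n" "b < n" "c < n"
  shows "raise3 n (\<lambda>i j. if i = j then 1 else 0) R j a b c = R j a b c"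
proof -
  have delta: "(\<Sum>x<n. k * (if y = x then 1 else 0) * f x) = k * f y" if "y < n" for k y and f :: "nat \<Rightarrow> real"
  proof -
    have "(\<Sum>x<n. k * (if y = x then 1 else 0) * f x) = (\<Sum>x\<in>{y}. k * (if y = x then 1 else 0) * f x)"
      using that by (intro sum.mono_neutral_right) auto
    then show ?thesis by simp
  qed
  have "raise3 n (\<lambda>i j. if i = j then 1 else 0) R j a b c
      = (\<Sum>a'<n. \<Sum>b'<n. (if a = a' then 1 else 0) * (if b = b' then 1 else 0) * R j a' b' c)"
    unfolding raise3_def using delta[OF assms(3)] by simp
  also have "\<dots> = (\<Sum>a'<n. 1 * (if a = a' then 1 else 0) * R j a' b c)"
    using delta[OF assms(2)] by simp
  also have "\<dots> = R j a b c"
    using delta[OF assms(1), of 1 "\<lambda>a'. R j a' b c"] by simp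
  finally show ?thesis .
qed

lemma christoffel_eq_0:
  assumes "\<And>i j k. n \<le> i \<or> n \<le> j \<or> n \<le> k \<Longrightarrow> C i j k = 0" "n \<le> i \<or> n \<le> j \<or> n \<le> k"
  shows "christoffel C i j k = 0"
  unfolding christoffel_def using assms by auto

text \<open>Padded indices are flat directions, as in a product with an abelian factor: if an outer
  index is padded, every product in the sum contains a vanishing factor.\<close>

lemma frame_curvature_eq_0:
  assumes "\<And>i j k. n \<le> i \<or> n \<le> j \<or> n \<le> k \<Longrightarrow> C i j k = 0" "n \<le> x \<or> n \<le> y \<or> n \<le> u \<or> n \<le> v"
  shows "frame_curvature m C x y u v = 0"
  unfolding frame_curvature_def
  by (rule sum.neutral, rule ballI)
    (use assms(2) in \<open>auto simp: christoffel_eq_0[of n C, OF assms(1)] assms(1)\<close>)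

lemma frame_curvature_truncate:
  assumes "\<And>i j k. n \<le> i \<or> n \<le> j \<or> n \<le> k \<Longrightarrow> C i j k = 0" "n \<le> m"
  shows "frame_curvature m C x y u v = frame_curvature n C x y u v"
  unfolding frame_curvature_def
  by (rule sum_lessThan_truncate[OF assms(2)])
    (simp add: christoffel_eq_0[of n C, OF assms(1)] assms(1))

section \<open>Adapted orthonormal bases\<close>

text \<open>The span I of the vectors found so far is invariant under every \<open>B x\<close>. Take
  the least k with N k inside I. As N 0 is the whole space and I is proper, k = Suc l, and any v in
  N l outside I is central modulo I, since B x v lies in N k. The next vector is v made orthogonal
  to I and normalised.\<close>

lemma nilpotent_orthonormal_flag:
  fixes G :: "'e::euclidean_space \<Rightarrow> 'e \<Rightarrow> real" and B :: "'e \<Rightarrow> 'e \<Rightarrow> 'e" and N :: "nat \<Rightarrow> 'e set"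
  assumes G: "bilinear G" and G_sym: "\<And>x y. G x y = G y x" and G_pos: "\<And>x. x \<noteq> 0 \<Longrightarrow> G x x > 0"
    and B: "bilinear B"
    and N0: "N 0 = UNIV" and N_step: "\<And>k x y. y \<in> N k \<Longrightarrow> B x y \<in> N (Suc k)" and N_end: "N m \<subseteq> {0}"
  shows "d \<le> DIM('e) \<Longrightarrow> \<exists>e :: nat \<Rightarrow> 'e. (\<forall>i<d. \<forall>j<d. G (e i) (e j) = (if i = j then 1 else 0)) \<and>
     (\<forall>i<d. \<forall>x. B x (e i) \<in> span (e ` {..<i}))"
proof (induction d)
  case 0
  then show ?case by simp
next
  case (Suc d)
  then obtain e :: "nat \<Rightarrow> 'e" where "\<forall>i<d. \<forall>j<d. G (e i) (e j) = (if i = j then 1 else 0)"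
    and "\<forall>i<d. \<forall>x. B x (e i) \<in> span (e ` {..<i})" using Suc_leD by blast
  then have on: "\<And>i j. i < d \<Longrightarrow> j < d \<Longrightarrow> G (e i) (e j) = (if i = j then 1 else 0)"
    and fl: "\<And>i x. i < d \<Longrightarrow> B x (e i) \<in> span (e ` {..<i})" by simp_all
  let ?I = "span (e ` {..<d})"
  have "dim (e ` {..<d}) \<le> d"
    using dim_le_card'[of "e ` {..<d}"] card_image_le[of "{..<d}" e] by simp
  then have "?I \<noteq> UNIV"
    using Suc.prems dim_UNIV[where 'a='e] by (metis Suc_le_lessD dim_span leD order.strict_trans2)
  have ideal: "B x y \<in> ?I" if "y \<in> ?I" for x y
    using that
  proof (induction rule: span_induct_alt)
    case base
    then show ?case by (simp add: bilinear_rzero[OF B] span_zero)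
  next
    case (step c z y)
    then obtain i where "i < d" "z = e i" by auto
    then have "B x z \<in> ?I"
      using fl[of i x] span_mono[of "e ` {..<i}" "e ` {..<d}"] by fastforce
    with step show ?case
      by (simp add: bilinear_radd[OF B] bilinear_rmul[OF B] span_add span_scale)
  qed
  define k where "k = (LEAST k. N k \<subseteq> ?I)"
  have "N m \<subseteq> ?I"
    using N_end span_zero by blast
  then have k: "N k \<subseteq> ?I" unfolding k_def by (rule LeastI)
  have k_min: "\<not> N l \<subseteq> ?I" if "l < k" for l
    using not_less_Least[OF that[unfolded k_def]] .
  have "k \<noteq> 0" using k N0 \<open>?I \<noteq> UNIV\<close> by auto
  then obtain l where l: "k = Suc l" using not0_implies_Suc by blast
  then obtain v where v: "v \<in> N l" "v \<notin> ?I" using k_min by blast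
  have Bv: "B x v \<in> ?I" for x using N_step[OF v(1)] k l by blast
  define p where "p = (\<Sum>i<d. G v (e i) *\<^sub>R e i)"
  have p: "p \<in> ?I" unfolding p_def by (intro span_sum span_scale span_base) auto
  define w where "w = v - p"
  have "w \<noteq> 0" using v p by (auto simp: w_def)
  have wG: "G w (e j) = 0" if "j < d" for j
  proof -
    have "G p (e j) = (\<Sum>i<d. G v (e i) * G (e i) (e j))"
      unfolding p_def using G
      by (simp add: bilinear_def linear_sum[of "\<lambda>x. G x (e j)"] linear_scale[of "\<lambda>x. G x (e j)"])
    also have "\<dots> = (\<Sum>i<d. if i = j then G v (e j) else 0)"
      by (rule sum.cong) (auto simp: on that)
    finally have "G p (e j) = G v (e j)" using that by simp
    then show ?thesis by (simp add: w_def bilinear_lsub[OF G])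
  qed
  define u where "u = (1 / sqrt (G w w)) *\<^sub>R w"
  have uu: "G u u = 1" and uG: "\<And>j. j < d \<Longrightarrow> G u (e j) = 0"
    using G_pos[OF \<open>w \<noteq> 0\<close>] wG
    by (simp_all add: u_def bilinear_lmul[OF G] bilinear_rmul[OF G] field_simps)
  have Gu: "G (e j) u = 0" if "j < d" for j using uG[OF that] G_sym by metis
  \<comment> \<open>Subtracting the projection p keeps the vector central modulo I, because p lies
    in I and I is an ideal.\<close>
  have Bu: "B x u \<in> ?I" for x
    using Bv ideal[OF p] by (simp add: u_def w_def bilinear_rmul[OF B] bilinear_rsub[OF B] span_scale span_diff)
  let ?e = "e(d := u)"
  have img: "?e ` {..<i} = e ` {..<i}" if "i \<le> d" for i
    using that by (intro image_cong) auto
  show ?case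
  proof (intro exI[of _ ?e] conjI allI impI)
    fix i j assume "i < Suc d" "j < Suc d"
    then show "G (?e i) (?e j) = (if i = j then 1 else 0)"
      using on uu uG Gu by (auto simp: less_Suc_eq)
  next
    fix i x assume "i < Suc d"
    then show "B x (?e i) \<in> span (?e ` {..<i})"
      using fl Bu by (cases "i = d") (simp_all add: img)
  qed
qed

text \<open>Pairing with e_j reads off the j-th coefficient of a combination. This yields
  independence, hence spanning by dimension, and then identifies the coefficients.\<close>

lemma orthonormal_expansion:
  fixes G :: "'e::euclidean_space \<Rightarrow> 'e \<Rightarrow> real" and e :: "nat \<Rightarrow> 'e"
  assumes G: "bilinear G"
    and on: "\<And>i j. i < DIM('e) \<Longrightarrow> j < DIM('e) \<Longrightarrow> G (e i) (e j) = (if i = j then 1 else 0)"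
  shows "x = (\<Sum>i<DIM('e). G x (e i) *\<^sub>R e i)"
proof -
  let ?E = "e ` {..<DIM('e)}"
  have G_sum: "G (\<Sum>i<DIM('e). f i *\<^sub>R e i) (e j) = f j" if "j < DIM('e)" for f j
  proof -
    have "G (\<Sum>i<DIM('e). f i *\<^sub>R e i) (e j) = (\<Sum>i<DIM('e). f i * G (e i) (e j))"
      using G by (simp add: bilinear_def linear_sum[of "\<lambda>x. G x (e j)"] linear_scale[of "\<lambda>x. G x (e j)"])
    also have "\<dots> = (\<Sum>i<DIM('e). if i = j then f j else 0)"
      by (rule sum.cong) (auto simp: on that)
    finally show ?thesis using that by simp
  qed
  have inj: "inj_on e {..<DIM('e)}"
    by (rule inj_onI) (metis lessThan_iff on zero_neq_one)
  have "independent ?E"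
  proof (rule independent_if_scalars_zero)
    fix f x assume 0: "(\<Sum>x\<in>?E. f x *\<^sub>R x) = 0" and "x \<in> ?E"
    then obtain j where j: "j < DIM('e)" "x = e j" by auto
    from 0 have "(\<Sum>i<DIM('e). f (e i) *\<^sub>R e i) = 0" by (simp add: sum.reindex[OF inj])
    then show "f x = 0" using G_sum[OF j(1), of "\<lambda>i. f (e i)"] j(2) bilinear_lzero[OF G] by simp
  qed simp
  moreover have "card ?E = DIM('e)" by (simp add: card_image inj)
  ultimately have "span ?E = UNIV"
    by (metis card_eq_dim dim_UNIV span_UNIV subset_UNIV top.extremum_uniqueI finite_imageI finite_lessThan)
  then have "x \<in> span ?E" by simp
  then obtain f where "x = (\<Sum>y\<in>?E. f y *\<^sub>R y)" by (auto simp: span_finite)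
  then have x: "x = (\<Sum>i<DIM('e). f (e i) *\<^sub>R e i)" by (simp add: sum.reindex[OF inj])
  have "G x (e j) = f (e j)" if "j < DIM('e)" for j
    using G_sum[OF that, of "\<lambda>i. f (e i)"] x by simp
  then have "(\<Sum>i<DIM('e). G x (e i) *\<^sub>R e i) = (\<Sum>i<DIM('e). f (e i) *\<^sub>R e i)"
    by (intro sum.cong) auto
  with x show ?thesis by metis
qed

section \<open>Left-invariant metrics\<close>

lemma vf_span_base: "X \<in> S \<Longrightarrow> X \<in> vf_span S"
  unfolding vf_span_def
  by (rule CollectI, rule exI[of _ 1], rule exI[of _ "\<lambda>i. 1"], rule exI[of _ "\<lambda>i. X"]) simp

text \<open>D plays the part of the connection supplied by the existential quantifier in
  \<open>weakly_einstein\<close>.\<close>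

locale left_invariant_geometry = based_lie_group A U\<^sub>0 \<phi>\<^sub>0
  for A :: "('g::{topological_group_add, t2_space, second_countable_topology},
             'e::euclidean_space) chart set" and U\<^sub>0 \<phi>\<^sub>0 +
  fixes g :: "'g metric" and D :: "'g connection"
  assumes metric: "riemannian_metric A g" and invariant: "left_invariant_metric A g"
    and connection: "levi_civita A g D"
begin

lemma g_sym: "u \<in> tangent_space A p \<Longrightarrow> v \<in> tangent_space A p \<Longrightarrow> g p u v = g p v u"
  using metric unfolding riemannian_metric_def by blast

lemma g_add:
  "u \<in> tangent_space A p \<Longrightarrow> v \<in> tangent_space A p \<Longrightarrow> w \<in> tangent_space A p
    \<Longrightarrow> g p (\<lambda>f. u f + v f) w = g p u w + g p v w"
  using metric unfolding riemannian_metric_def by blast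

lemma g_scale:
  "u \<in> tangent_space A p \<Longrightarrow> v \<in> tangent_space A p \<Longrightarrow> g p (\<lambda>f. c * u f) v = c * g p u v"
  using metric unfolding riemannian_metric_def by blast

lemma g_pos: "v \<in> tangent_space A p \<Longrightarrow> v \<noteq> (\<lambda>f. 0) \<Longrightarrow> g p v v > 0"
  using metric unfolding riemannian_metric_def by blast

lemma g_diff:
  assumes "u \<in> tangent_space A p" "v \<in> tangent_space A p" "w \<in> tangent_space A p"
  shows "g p (\<lambda>f. u f - v f) w = g p u w - g p v w"
  using g_add[OF assms(1) tangent_space_scale[OF assms(2), of "-1"] assms(3)] g_scale[OF assms(2,3), of "-1"]
  by simp

definition lie_inner :: "'e \<Rightarrow> 'e \<Rightarrow> real" where
  "lie_inner \<xi> \<eta> = g 0 (left_field \<xi> 0) (left_field \<eta> 0)"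

lemma g_left_field: "g p (left_field \<xi> p) (left_field \<eta> p) = lie_inner \<xi> \<eta>"
proof -
  have "g (p + 0) (left_push p (left_field \<xi> 0)) (left_push p (left_field \<eta> 0)) = lie_inner \<xi> \<eta>"
    unfolding lie_inner_def using invariant left_field_tangent unfolding left_invariant_metric_def by blast
  then show ?thesis by (simp add: left_push_left_field)
qed

lemma lie_inner_sym: "lie_inner \<xi> \<eta> = lie_inner \<eta> \<xi>"
  unfolding lie_inner_def by (intro g_sym left_field_tangent)

lemma lie_inner_bilinear: "bilinear lie_inner"
proof -
  have "linear (\<lambda>\<xi>. lie_inner \<xi> \<eta>)" for \<eta>
    unfolding lie_inner_def left_field_add left_field_scale vf_add_def
    by (rule linearI) (simp_all add: left_field_add left_field_scale vf_add_def g_add g_scale left_field_tangent)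
  moreover have "lie_inner \<eta> = (\<lambda>\<xi>. lie_inner \<xi> \<eta>)" for \<eta>
    by (rule ext) (rule lie_inner_sym)
  ultimately show ?thesis unfolding bilinear_def by metis
qed

lemma lie_inner_pos: "\<xi> \<noteq> 0 \<Longrightarrow> lie_inner \<xi> \<xi> > 0"
  unfolding lie_inner_def using g_pos left_field_tangent left_field_eq_0D by blast

lemma D_smooth: "X \<in> smooth_vfields A \<Longrightarrow> Y \<in> smooth_vfields A \<Longrightarrow> D X Y \<in> smooth_vfields A"
  using connection unfolding levi_civita_def affine_connection_def by blast

lemma torsion_free:
  "X \<in> smooth_vfields A \<Longrightarrow> Y \<in> smooth_vfields A \<Longrightarrow> vf_diff (D X Y) (D Y X) = lie_bracket A X Y"
  using connection unfolding levi_civita_def by blast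

lemma metric_compatible:
  "X \<in> smooth_vfields A \<Longrightarrow> Y \<in> smooth_vfields A \<Longrightarrow> Z \<in> smooth_vfields A
    \<Longrightarrow> X p (metric_fun g Y Z) = g p (D X Y p) (Z p) + g p (Y p) (D X Z p)"
  using connection unfolding levi_civita_def by blast

text \<open>The Lie bracket transported to \<open>'e\<close> along \<open>left_field\<close>. The
  description is met because brackets of left-invariant fields are again left-invariant, and unique
  by \<open>left_field_inject\<close>.\<close>

definition bracket :: "'e \<Rightarrow> 'e \<Rightarrow> 'e" where
  "bracket \<xi> \<eta> = (THE \<zeta>. left_field \<zeta> = lie_bracket A (left_field \<xi>) (left_field \<eta>))"

lemma left_field_bracket:
  "left_field (bracket \<xi> \<eta>) = lie_bracket A (left_field \<xi>) (left_field \<eta>)"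
proof -
  \<comment> \<open>The smoothness of the bracket comes for free from the torsion-freeness of \<open>D\<close>.\<close>
  have "lie_bracket A (left_field \<xi>) (left_field \<eta>) \<in> smooth_vfields A"
    unfolding torsion_free[OF left_field_smooth left_field_smooth, symmetric]
    by (intro smooth_vfields_diff D_smooth left_field_smooth)
  then have "lie_bracket A (left_field \<xi>) (left_field \<eta>) \<in> lie_algebra A"
    using lie_bracket_left_invariant[OF left_field_lie_algebra left_field_lie_algebra]
    by (simp add: lie_algebra_def)
  then obtain \<zeta> where "left_field \<zeta> = lie_bracket A (left_field \<xi>) (left_field \<eta>)"
    using lie_algebra_left_field by metis
  then show ?thesis
    unfolding bracket_def by (rule theI) (metis left_field_inject \<open>left_field \<zeta> = _\<close>)
qed

lemma bracket_skew: "bracket \<xi> \<eta> = - bracket \<eta> \<xi>"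
proof -
  have "left_field (bracket \<xi> \<eta>) p f = left_field ((-1) *\<^sub>R bracket \<eta> \<xi>) p f" for p f
    unfolding left_field_scale left_field_bracket
    using lie_bracket_skew[of "left_field \<xi>" "left_field \<eta>" p f] by simp
  then have "left_field (bracket \<xi> \<eta>) = left_field ((-1) *\<^sub>R bracket \<eta> \<xi>)" by blast
  then show ?thesis by (simp add: left_field_inject)
qed

lemma bracket_bilinear: "bilinear bracket"
proof -
  have *: "linear (bracket \<xi>)" for \<xi>
  proof (rule linearI)
    fix \<eta> \<zeta> c
    have "left_field (bracket \<xi> (\<eta> + \<zeta>)) = left_field (bracket \<xi> \<eta> + bracket \<xi> \<zeta>)"
      by (simp add: left_field_bracket left_field_add lie_bracket_add_right left_field_smooth)
    then show "bracket \<xi> (\<eta> + \<zeta>) = bracket \<xi> \<eta> + bracket \<xi> \<zeta>" by (simp add: left_field_inject)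
    have "left_field (bracket \<xi> (c *\<^sub>R \<eta>)) = left_field (c *\<^sub>R bracket \<xi> \<eta>)"
      by (simp add: left_field_bracket left_field_scale lie_bracket_scale_right left_field_smooth)
    then show "bracket \<xi> (c *\<^sub>R \<eta>) = c *\<^sub>R bracket \<xi> \<eta>" by (simp add: left_field_inject)
  qed
  have "linear (\<lambda>\<xi>. bracket \<xi> \<eta>)" for \<eta>
    using linear_compose_neg[OF *[of \<eta>]] unfolding bracket_skew[of _ \<eta>] .
  with * show ?thesis unfolding bilinear_def by blast
qed

definition koszul :: "'e \<Rightarrow> 'e \<Rightarrow> 'e \<Rightarrow> real" where
  "koszul \<xi> \<eta> \<zeta> = (lie_inner (bracket \<xi> \<eta>) \<zeta> - lie_inner (bracket \<eta> \<zeta>) \<xi> + lie_inner (bracket \<zeta> \<xi>) \<eta>) / 2"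

lemma koszul_linear:
  shows "linear (\<lambda>\<xi>. koszul \<xi> \<eta> \<zeta>)" "linear (\<lambda>\<eta>. koszul \<xi> \<eta> \<zeta>)"
  by (rule linearI; simp add: koszul_def bilinear_ladd[OF lie_inner_bilinear] bilinear_radd[OF lie_inner_bilinear]
      bilinear_ladd[OF bracket_bilinear] bilinear_radd[OF bracket_bilinear]
      bilinear_lmul[OF lie_inner_bilinear] bilinear_rmul[OF lie_inner_bilinear]
      bilinear_lmul[OF bracket_bilinear] bilinear_rmul[OF bracket_bilinear] field_simps)+

lemma D_left_field_tangent: "D (left_field \<xi>) (left_field \<eta>) p \<in> tangent_space A p"
  by (intro smooth_vfields_tangent[of _ A] D_smooth left_field_smooth)

text \<open>Inner products of left-invariant fields are constant, so metric compatibility makes k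
  skew in its last two arguments, while torsion-freeness gives its skew part in the first two. Three
  instances of the former determine k.\<close>

lemma koszul_formula:
  "g p (D (left_field \<xi>) (left_field \<eta>) p) (left_field \<zeta> p) = koszul \<xi> \<eta> \<zeta>"
proof -
  define k where "k \<xi> \<eta> \<zeta> = g p (D (left_field \<xi>) (left_field \<eta>) p) (left_field \<zeta> p)" for \<xi> \<eta> \<zeta>
  have m: "k \<xi> \<eta> \<zeta> + k \<xi> \<zeta> \<eta> = 0" for \<xi> \<eta> \<zeta>
  proof -
    have "metric_fun g (left_field \<eta>) (left_field \<zeta>) = (\<lambda>q. lie_inner \<eta> \<zeta>)"
      by (simp add: metric_fun_def g_left_field)
    then have "left_field \<xi> p (metric_fun g (left_field \<eta>) (left_field \<zeta>)) = 0"
      using tangent_const[OF left_field_tangent] by simp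
    then show ?thesis
      using metric_compatible[OF left_field_smooth left_field_smooth left_field_smooth, of \<xi> p \<eta> \<zeta>]
        g_sym[OF D_left_field_tangent left_field_tangent, of p \<xi> \<zeta> \<eta>]
      by (simp add: k_def)
  qed
  have t: "k \<xi> \<eta> \<zeta> - k \<eta> \<xi> \<zeta> = lie_inner (bracket \<xi> \<eta>) \<zeta>" for \<xi> \<eta> \<zeta>
  proof -
    have "left_field (bracket \<xi> \<eta>) p =
        (\<lambda>f. D (left_field \<xi>) (left_field \<eta>) p f - D (left_field \<eta>) (left_field \<xi>) p f)"
      unfolding left_field_bracket torsion_free[OF left_field_smooth left_field_smooth, symmetric]
      by (simp add: vf_diff_def)
    then show ?thesis
      using g_diff[OF D_left_field_tangent D_left_field_tangent left_field_tangent, of p \<xi> \<eta> \<eta> \<xi> \<zeta>]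
        g_left_field[of p "bracket \<xi> \<eta>" \<zeta>]
      by (simp add: k_def)
  qed
  have "2 * k \<xi> \<eta> \<zeta> = lie_inner (bracket \<xi> \<eta>) \<zeta> - lie_inner (bracket \<eta> \<zeta>) \<xi> + lie_inner (bracket \<zeta> \<xi>) \<eta>"
    unfolding t[symmetric] using m[of \<xi> \<eta> \<zeta>] m[of \<eta> \<xi> \<zeta>] m[of \<zeta> \<xi> \<eta>] by algebra
  then show ?thesis by (simp add: k_def koszul_def)
qed

section \<open>Covariant derivative and curvature in an orthonormal frame\<close>

context
  fixes e :: "nat \<Rightarrow> 'e" and n :: nat
  assumes n: "n = DIM('e)"
    and on: "\<And>i j. i < n \<Longrightarrow> j < n \<Longrightarrow> lie_inner (e i) (e j) = (if i = j then 1 else 0)"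
begin

lemma expansion: "x = (\<Sum>i<n. lie_inner x (e i) *\<^sub>R e i)"
  using orthonormal_expansion[OF lie_inner_bilinear, of e x] on unfolding n by blast

definition nabla :: "'e \<Rightarrow> 'e \<Rightarrow> 'e" where
  "nabla \<xi> \<eta> = (\<Sum>k<n. koszul \<xi> \<eta> (e k) *\<^sub>R e k)"

text \<open>At each p the derivative is the value of some left field, whose frame coefficients are
  those of \<open>koszul_formula\<close> and thus independent of p. Hence D preserves
  left-invariance.\<close>

lemma D_left_field: "D (left_field \<xi>) (left_field \<eta>) = left_field (nabla \<xi> \<eta>)"
proof (rule ext)
  fix p
  obtain \<zeta> where \<zeta>: "D (left_field \<xi>) (left_field \<eta>) p = left_field \<zeta> p"
    using tangent_left_field[OF D_left_field_tangent] .
  have "lie_inner \<zeta> (e k) = koszul \<xi> \<eta> (e k)" for k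
    using koszul_formula[of p \<xi> \<eta> "e k"] g_left_field[of p \<zeta> "e k"] \<zeta> by simp
  then have "\<zeta> = nabla \<xi> \<eta>" using expansion[of \<zeta>] by (simp add: nabla_def)
  with \<zeta> show "D (left_field \<xi>) (left_field \<eta>) p = left_field (nabla \<xi> \<eta>) p" by simp
qed

lemma lie_inner_nabla: "lie_inner (nabla \<xi> \<eta>) \<zeta> = koszul \<xi> \<eta> \<zeta>"
  using koszul_formula[of 0 \<xi> \<eta> \<zeta>] by (simp add: D_left_field lie_inner_def)

lemma curvature_tensor_left_field:
  assumes "a < n" "b < n" "c < n" "d < n"
  shows "curvature_tensor A g D (left_field (e a)) (left_field (e b)) (left_field (e c)) (left_field (e d)) p
    = frame_curvature n (\<lambda>i j k. lie_inner (bracket (e i) (e j)) (e k)) a b c d"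
proof -
  have kc: "koszul (e i) (e j) (e k) = christoffel (\<lambda>i j k. lie_inner (bracket (e i) (e j)) (e k)) i j k" for i j k
    by (simp add: koszul_def christoffel_def)
  \<comment> \<open>Expanding the differentiated vector yields the two products of second
    derivatives; expanding the direction, as in kl, yields the bracket term.\<close>
  have kr: "koszul \<xi> \<eta> \<zeta> = (\<Sum>k<n. lie_inner \<eta> (e k) * koszul \<xi> (e k) \<zeta>)" for \<xi> \<eta> \<zeta>
    by (subst expansion[of \<eta>]) (simp add: linear_sum[OF koszul_linear(2)] linear_scale[OF koszul_linear(2)])
  have kl: "koszul \<xi> \<eta> \<zeta> = (\<Sum>k<n. lie_inner \<xi> (e k) * koszul (e k) \<eta> \<zeta>)" for \<xi> \<eta> \<zeta>
    by (subst expansion[of \<xi>]) (simp add: linear_sum[OF koszul_linear(1)] linear_scale[OF koszul_linear(1)])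
  let ?L = left_field
  have "curvature_operator A D (?L (e a)) (?L (e b)) (?L (e c)) p
      = (\<lambda>f. (?L (nabla (e a) (nabla (e b) (e c))) p f - ?L (nabla (e b) (nabla (e a) (e c))) p f)
          - ?L (nabla (bracket (e a) (e b)) (e c)) p f)"
    by (simp add: curvature_operator_def D_left_field left_field_bracket[symmetric] vf_diff_def)
  moreover have "(\<lambda>f. ?L (nabla (e a) (nabla (e b) (e c))) p f - ?L (nabla (e b) (nabla (e a) (e c))) p f)
      \<in> tangent_space A p"
    using tangent_space_add[OF left_field_tangent tangent_space_scale[OF left_field_tangent, of "-1"]]
    by simp
  ultimately have "curvature_tensor A g D (?L (e a)) (?L (e b)) (?L (e c)) (?L (e d)) p
      = koszul (e a) (nabla (e b) (e c)) (e d) - koszul (e b) (nabla (e a) (e c)) (e d)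
        - koszul (bracket (e a) (e b)) (e c) (e d)"
    by (simp add: curvature_tensor_def metric_fun_def g_diff left_field_tangent g_left_field lie_inner_nabla)
  also have "\<dots> = (\<Sum>k<n. koszul (e b) (e c) (e k) * koszul (e a) (e k) (e d)
      - koszul (e a) (e c) (e k) * koszul (e b) (e k) (e d)
      - lie_inner (bracket (e a) (e b)) (e k) * koszul (e k) (e c) (e d))"
    unfolding kr[of "e a" "nabla (e b) (e c)"] kr[of "e b" "nabla (e a) (e c)"]
      kl[of "bracket (e a) (e b)"] lie_inner_nabla by (simp add: sum_subtractf)
  finally show ?thesis unfolding kc frame_curvature_def .
qed

end

text \<open>The flag lemma is applied to the coordinate vectors of the lower central series, and
  orthonormality turns membership in a span into vanishing coefficients. The flag controls the
  second argument of the bracket; skew-symmetry supplies the case i \<le> k.\<close>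

lemma adapted_orthonormal_frame:
  assumes "nilpotent_lie_algebra A (lie_algebra A)"
  obtains e :: "nat \<Rightarrow> 'e"
  where "\<And>i j. i < DIM('e) \<Longrightarrow> j < DIM('e) \<Longrightarrow> lie_inner (e i) (e j) = (if i = j then 1 else 0)"
    and "\<And>i j k. i < DIM('e) \<Longrightarrow> j < DIM('e) \<Longrightarrow> k < DIM('e) \<Longrightarrow> i \<le> k \<or> j \<le> k
      \<Longrightarrow> lie_inner (bracket (e i) (e j)) (e k) = 0"
proof -
  let ?N = "\<lambda>k. {\<xi>. left_field \<xi> \<in> lower_central_series A (lie_algebra A) k}"
  obtain m where m: "lower_central_series A (lie_algebra A) m = {vf_zero}"
    using assms unfolding nilpotent_lie_algebra_def by blast
  have "?N 0 = UNIV" using left_field_lie_algebra by simp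
  moreover have "bracket x y \<in> ?N (Suc k)" if "y \<in> ?N k" for k x y
    using that left_field_lie_algebra[of x] by (auto simp: left_field_bracket intro!: vf_span_base)
  moreover have "?N m \<subseteq> {0}"
    using left_field_inject[of _ 0] by (auto simp: m left_field_0)
  ultimately obtain e :: "nat \<Rightarrow> 'e"
    where on: "\<forall>i<DIM('e). \<forall>j<DIM('e). lie_inner (e i) (e j) = (if i = j then 1 else 0)"
      and fl: "\<forall>i<DIM('e). \<forall>x. bracket x (e i) \<in> span (e ` {..<i})"
    using nilpotent_orthonormal_flag[OF lie_inner_bilinear lie_inner_sym lie_inner_pos bracket_bilinear, of ?N m "DIM('e)"]
    by blast
  have orth: "lie_inner x (e k) = 0" if "x \<in> span (e ` {..<j})" "j \<le> k" "k < DIM('e)" for x j k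
    using that(1)
  proof (induction rule: span_induct_alt)
    case base
    then show ?case by (rule bilinear_lzero[OF lie_inner_bilinear])
  next
    case (step c z y)
    then obtain i where "i < j" "z = e i" by auto
    then have "lie_inner z (e k) = 0" using on that(2,3) by simp
    with step show ?case by (simp add: bilinear_ladd[OF lie_inner_bilinear] bilinear_lmul[OF lie_inner_bilinear])
  qed
  have "lie_inner (bracket (e i) (e j)) (e k) = 0"
    if ij: "i < DIM('e)" "j < DIM('e)" and k: "k < DIM('e)" "i \<le> k \<or> j \<le> k" for i j k
    using k(2)
  proof
    assume "j \<le> k"
    then show ?thesis using orth fl ij k(1) by blast
  next
    assume "i \<le> k"
    then have "lie_inner (bracket (e j) (e i)) (e k) = 0" using orth fl ij k(1) by blast
    then show ?thesis by (subst bracket_skew) (simp add: bilinear_lneg[OF lie_inner_bilinear])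
  qed
  with on show ?thesis by (intro that[of e]) auto
qed

text \<open>If all structure constants vanished, expanding both arguments in the frame would make
  \<open>bracket\<close> zero, and every left-invariant field is a
  \<open>left_field\<close>.\<close>

lemma non_abelian_structure_constant:
  assumes "\<not> abelian_lie_algebra A (lie_algebra A)"
    and on: "\<And>i j. i < DIM('e) \<Longrightarrow> j < DIM('e) \<Longrightarrow> lie_inner (e i) (e j) = (if i = j then 1 else 0)"
  obtains i j k where "i < DIM('e)" "j < DIM('e)" "k < DIM('e)" "lie_inner (bracket (e i) (e j)) (e k) \<noteq> 0"
proof (rule ccontr)
  assume "\<not> thesis"
  with that have 0: "lie_inner (bracket (e i) (e j)) (e k) = 0"
    if "i < DIM('e)" "j < DIM('e)" "k < DIM('e)" for i j k using that by blast
  note exp = expansion[OF refl on]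
  have e: "bracket (e i) (e j) = 0" if "i < DIM('e)" "j < DIM('e)" for i j
  proof -
    have "bracket (e i) (e j) = (\<Sum>k<DIM('e). lie_inner (bracket (e i) (e j)) (e k) *\<^sub>R e k)" by (rule exp)
    also have "\<dots> = 0" using 0 that by (intro sum.neutral) auto
    finally show ?thesis .
  qed
  have "bracket \<xi> \<eta> = 0" for \<xi> \<eta>
  proof -
    have "bracket \<xi> \<eta> =
        bracket (\<Sum>i<DIM('e). lie_inner \<xi> (e i) *\<^sub>R e i) (\<Sum>j<DIM('e). lie_inner \<eta> (e j) *\<^sub>R e j)"
      using exp[of \<xi>] exp[of \<eta>] by simp
    also have "\<dots> = 0"
      unfolding bilinear_sum[OF bracket_bilinear]
      by (auto simp: bilinear_lmul[OF bracket_bilinear] bilinear_rmul[OF bracket_bilinear] e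
          intro!: sum.neutral)
    finally show ?thesis .
  qed
  then have "lie_bracket A X Y = vf_zero" if "X \<in> lie_algebra A" "Y \<in> lie_algebra A" for X Y
    using that lie_algebra_left_field left_field_bracket left_field_0 by metis
  with assms(1) show False unfolding abelian_lie_algebra_def by blast
qed

text \<open>The hypothesis \<open>we\<close> is the weakly Einstein condition at the unit in the
  component 0 0. For the adapted frame the Gram matrix is the identity, so \<open>R_check\<close>
  and \<open>R_norm_sq\<close> become sums of squares.\<close>

lemma weakly_einstein_impossible:
  assumes dim: "DIM('e) \<le> 5"
    and nilpotent: "nilpotent_lie_algebra A (lie_algebra A)"
    and non_abelian: "\<not> abelian_lie_algebra A (lie_algebra A)"
    and we: "\<And>E gi. (\<forall>i<DIM('e). E i \<in> smooth_vfields A) \<Longrightarrow>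
      (\<forall>i<DIM('e). \<forall>k<DIM('e).
         (\<Sum>j<DIM('e). gi i j * g 0 (E j 0) (E k 0)) = (if i = k then 1 else 0)) \<Longrightarrow>
      R_check DIM('e) gi (\<lambda>i a b c. curvature_tensor A g D (E i) (E a) (E b) (E c) 0) 0 0
        = R_norm_sq DIM('e) gi (\<lambda>i a b c. curvature_tensor A g D (E i) (E a) (E b) (E c) 0)
          / real DIM('e) * g 0 (E 0 0) (E 0 0)"
  shows False
proof -
  define n where "n = DIM('e)"
  have n: "0 < n" "n \<le> 5" using dim by (simp_all add: n_def)
  from adapted_orthonormal_frame[OF nilpotent] obtain e :: "nat \<Rightarrow> 'e"
    where on: "\<And>i j. i < n \<Longrightarrow> j < n \<Longrightarrow> lie_inner (e i) (e j) = (if i = j then 1 else 0)"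
      and flag: "\<And>i j k. i < n \<Longrightarrow> j < n \<Longrightarrow> k < n \<Longrightarrow> i \<le> k \<or> j \<le> k
        \<Longrightarrow> lie_inner (bracket (e i) (e j)) (e k) = 0"
    unfolding n_def by blast
  define c where "c i j k = lie_inner (bracket (e i) (e j)) (e k)" for i j k
  \<comment> \<open>Padding by zeros reduces all dimensions to the case of dimension 5.\<close>
  define C where "C i j k = (if i < n \<and> j < n \<and> k < n then c i j k else 0)" for i j k
  have C0: "C i j k = 0" if "n \<le> i \<or> n \<le> j \<or> n \<le> k" for i j k
    using that by (auto simp: C_def)
  have skew: "C i j k = - C j i k" for i j k
    unfolding C_def c_def by (subst bracket_skew) (simp add: bilinear_lneg[OF lie_inner_bilinear])
  have zero: "C i j k = 0" if "i \<le> k \<or> j \<le> k" for i j k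
    using flag[OF _ _ _ that] by (simp add: C_def c_def)
  have bound: "C i j k = 0" if "5 \<le> i" for i j k
    using that n by (intro C0) auto
  obtain i\<^sub>0 j\<^sub>0 k\<^sub>0 where nz: "C i\<^sub>0 j\<^sub>0 k\<^sub>0 \<noteq> 0"
    using non_abelian_structure_constant[OF non_abelian, of e] on
    unfolding C_def c_def n_def by metis
  define R where "R = frame_curvature 5 C"
  have R: "curvature_tensor A g D (left_field (e i)) (left_field (e x)) (left_field (e y))
      (left_field (e z)) 0 = R i x y z" if "i < n" "x < n" "y < n" "z < n" for i x y z
  proof -
    \<comment> \<open>Below n the padded and the original constants agree, so the curvatures summed
      over k < n agree; truncation then extends the range of k to 5.\<close>
    have "christoffel c i j k = christoffel C i j k" if "i < n" "j < n" "k < n" for i j k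
      using that by (simp add: christoffel_def C_def)
    then have "frame_curvature n c i x y z = frame_curvature n C i x y z"
      unfolding frame_curvature_def using that by (intro sum.cong) (auto simp: C_def)
    then show ?thesis
      using curvature_tensor_left_field[OF n_def on that, of 0]
        frame_curvature_truncate[of n C 5, OF C0 n(2)]
      by (simp add: R_def c_def[abs_def])
  qed
  have R0: "R i x y z = 0" if "n \<le> i \<or> n \<le> x \<or> n \<le> y \<or> n \<le> z" for i x y z
    unfolding R_def by (rule frame_curvature_eq_0[of n C, OF C0 that])
  let ?S = "\<lambda>m i. \<Sum>x<m. \<Sum>y<m. \<Sum>z<m. (R i x y z)\<^sup>2"
  have S5: "?S 5 i = ?S n i" for i
    using n(2) by (simp add: sum_lessThan_truncate[of n 5] R0)
  have T5: "(\<Sum>i<5. ?S n i) = (\<Sum>i<n. ?S n i)"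
    using n(2) by (intro sum_lessThan_truncate) (simp_all add: R0)
  have gap: "5 * ?S 5 0 < (\<Sum>i<5. ?S 5 i)"
    unfolding R_def by (rule frame_curvature_gap[of C, OF skew _ _ nz]) (use zero bound in auto)
  let ?\<delta> = "\<lambda>i j. if i = j then 1 else 0 :: real"
  let ?R = "\<lambda>i a b c. curvature_tensor A g D (left_field (e i)) (left_field (e a))
    (left_field (e b)) (left_field (e c)) 0"
  have delta: "(\<Sum>j<n. ?\<delta> i j * f j) = f i" if "i < n" for i and f :: "nat \<Rightarrow> real"
  proof -
    have "(\<Sum>j<n. ?\<delta> i j * f j) = (\<Sum>j\<in>{i}. ?\<delta> i j * f j)"
      using that by (intro sum.mono_neutral_right) auto
    then show ?thesis by simp
  qed
  have raise: "raise3 n ?\<delta> ?R i a b c = R i a b c" if "i < n" "a < n" "b < n" "c < n" for i a b c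
    using that by (simp add: raise3_delta R)
  have "R_check n ?\<delta> ?R 0 0 = ?S n 0"
    unfolding R_check_def by (intro sum.cong refl) (simp add: raise R n power2_eq_square)
  moreover have "R_norm_sq n ?\<delta> ?R = (\<Sum>i<n. ?S n i)"
    unfolding R_norm_sq_def by (intro sum.cong refl) (simp add: delta raise R power2_eq_square)
  moreover have "R_check n ?\<delta> ?R 0 0 = R_norm_sq n ?\<delta> ?R / real n
      * g 0 (left_field (e 0) 0) (left_field (e 0) 0)"
    unfolding n_def
  proof (rule we)
    show "\<forall>i<DIM('e). left_field (e i) \<in> smooth_vfields A" using left_field_smooth by blast
    show "\<forall>i<DIM('e). \<forall>k<DIM('e). (\<Sum>j<DIM('e). ?\<delta> i j * g 0 (left_field (e j) 0) (left_field (e k) 0)) = ?\<delta> i k"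
      unfolding n_def[symmetric] g_left_field using on by (simp add: delta)
  qed
  ultimately have "?S n 0 = (\<Sum>i<n. ?S n i) / real n"
    using on n by (simp add: g_left_field)
  then have "(\<Sum>i<n. ?S n i) = real n * ?S n 0" using n by (simp add: field_simps)
  \<comment> \<open>A sum of squares is nonnegative, so the factor n may be raised to 5, which
    contradicts the strict inequality \<open>gap\<close>.\<close>
  also have "\<dots> \<le> 5 * ?S n 0"
    using n by (intro mult_right_mono sum_nonneg) auto
  finally show False
    using gap unfolding S5 T5 by simp
qed

end

theorem theorem1p3:
  fixes A :: "('g::{topological_group_add, t2_space, second_countable_topology},
               'e::euclidean_space) chart set"
    and g :: "'g metric"
  assumes "lie_group A"
    and "connected (UNIV :: 'g set)"
    and "DIM('e) \<le> 5"
    and "nilpotent_lie_algebra A (lie_algebra A)"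
    and "\<not> abelian_lie_algebra A (lie_algebra A)"
    and "riemannian_metric A g"
    and "left_invariant_metric A g"
  shows "\<not> weakly_einstein A g"
proof
  assume "weakly_einstein A g"
  then obtain D where D: "levi_civita A g D" and we: "\<And>p E gi.
        (\<forall>i<DIM('e). E i \<in> smooth_vfields A) \<and>
        (\<forall>i<DIM('e). \<forall>k<DIM('e).
           (\<Sum>j<DIM('e). gi i j * g p (E j p) (E k p)) = (if i = k then 1 else 0)) \<Longrightarrow>
        (let R = (\<lambda>i a b c. curvature_tensor A g D (E i) (E a) (E b) (E c) p) in
         \<forall>i<DIM('e). \<forall>j<DIM('e).
           R_check DIM('e) gi R i j
             = R_norm_sq DIM('e) gi R / real DIM('e) * g p (E i p) (E j p))"
    unfolding weakly_einstein_def by blast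
  have "smooth_atlas A" using assms(1) by (simp add: lie_group_def)
  then obtain U \<phi> where "(U, \<phi>) \<in> A" "0 \<in> U"
    unfolding smooth_atlas_def by blast
  then interpret left_invariant_geometry A U \<phi> g D
    using assms D by unfold_locales
  show False
    using we[where p = 0] by (intro weakly_einstein_impossible assms(3-5)) (simp add: Let_def)
qed

end
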